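(* Let $(X,d)$ and $(Y,d')$ be proper $\delta$-hyperbolic geodesic metric spaces and let $\pi: Y\to X$ be a quasi-isometry with quasi-inverse $\varpi$. Then the functor $\Pi$ induced by $\pi$ sends the hyperbolic compactification of $X$ to the hyperbolic compactification of $Y$; that is, $\Pi(X+_{f_\infty}\partial_\infty(X))$ is isomorphic to $Y+_{f_\infty}\partial_\infty(Y)$ as a compactification of $Y$ (there is a homeomorphism between them that is the identity on $Y$).
   Context: $Closed(X)$ is the set of closed subsets of $X$. A map $f:Closed(X)\to Closed(W)$ is admissible if $f(\emptyset)=\emptyset$ and $f(A\cup B)=f(A)\cup f(B)$; $X+_fW$ is the disjoint union $X\dot\cup W$ in which $C$ is closed iff $C\cap X$ is closed in $X$, $C\cap W$ is closed in $W$ and $f(C\cap X)\subseteq C$. Every space that is the disjoint union of an open subspace $X$ and its complement $W$ is uniquely of this form, with $f(A)=Cl(A)-X$. The hyperbolic compactification of a proper $\delta$-hyperbolic geodesic space $X$ is the usual compactification $X\cup\partial_\infty(X)$ by the Gromov boundary (asymptotic classes of geodesic rays), written $X+_{f_\infty}\partial_\infty(X)$. The functor $\Pi$ induced by $\pi:Y\to X$ sends $X+_fW$ to $Y+_{f^*}W$, where $f^*(A)=f(Cl_X(\pi(A)))$ for $A\in Closed(Y)$ (the pullback of $f$ with respect to $\pi$ and $id_W$), and sends a morphism $id+\phi$ to $id+\phi$. *)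

theory Defs
  imports "HOL-Analysis.Analysis"
begin

section \<open>Gluing a space to a remainder along an admissible map\<close>

definition admissible :: "'a topology \<Rightarrow> 'w topology \<Rightarrow> ('a set \<Rightarrow> 'w set) \<Rightarrow> bool" where
  "admissible X W f \<longleftrightarrow>
     (\<forall>A. closedin X A \<longrightarrow> closedin W (f A)) \<and>
     f {} = {} \<and>
     (\<forall>A B. closedin X A \<longrightarrow> closedin X B \<longrightarrow> f (A \<union> B) = f A \<union> f B)"

definition glue_closed ::
  "'a topology \<Rightarrow> 'w topology \<Rightarrow> ('a set \<Rightarrow> 'w set) \<Rightarrow> ('a + 'w) set \<Rightarrow> bool" where
  "glue_closed X W f C \<longleftrightarrow>
     closedin X (Inl -` C) \<and> closedin W (Inr -` C) \<and> f (Inl -` C) \<subseteq> Inr -` C"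

text \<open>The space \<open>X +\<^sub>f W\<close>. The lemma \<open>closedin_glue\<close> below shows that, for admissible \<open>f\<close>,
  its closed sets are exactly those satisfying \<^const>\<open>glue_closed\<close>.\<close>

definition glue :: "'a topology \<Rightarrow> 'w topology \<Rightarrow> ('a set \<Rightarrow> 'w set) \<Rightarrow> ('a + 'w) topology" where
  "glue X W f = topology (\<lambda>U. U \<subseteq> topspace X <+> topspace W \<and>
     glue_closed X W f ((topspace X <+> topspace W) - U))"

text \<open>For a topology \<open>T\<close> on a disjoint union, the map \<open>f(A) = Cl(A) - X\<close> and the topology
  induced on the remainder.\<close>

definition attaching_map :: "('a + 'w) topology \<Rightarrow> 'a set \<Rightarrow> 'w set" where
  "attaching_map T A = Inr -` (T closure_of (Inl ` A))"

definition remainder :: "('a + 'w) topology \<Rightarrow> 'w topology" where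
  "remainder T = pullback_topology UNIV Inr T"

definition pullback_map ::
  "('b \<Rightarrow> 'a::topological_space) \<Rightarrow> ('a set \<Rightarrow> 'w set) \<Rightarrow> 'b set \<Rightarrow> 'w set" where
  "pullback_map \<pi> f A = f (closure (\<pi> ` A))"

text \<open>The functor induced by \<open>\<pi>\<close>, on objects. A space \<open>T = X +\<^sub>f W\<close> determines \<open>f\<close> (on closed sets)
  and \<open>W\<close>, so the functor can be applied to \<open>T\<close> itself; see \<open>Pi_functor_glue\<close> below.\<close>

definition Pi_functor ::
  "('b::topological_space \<Rightarrow> 'a::topological_space) \<Rightarrow> ('a + 'w) topology \<Rightarrow> ('b + 'w) topology" where
  "Pi_functor \<pi> T = glue euclidean (remainder T) (pullback_map \<pi> (attaching_map T))"

section \<open>Hyperbolic spaces and quasi-isometries\<close>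

definition proper_metric :: "'a::metric_space itself \<Rightarrow> bool" where
  "proper_metric _ \<longleftrightarrow> (\<forall>(x::'a) r. compact (cball x r))"

definition isometric_on :: "real set \<Rightarrow> (real \<Rightarrow> 'a::metric_space) \<Rightarrow> bool" where
  "isometric_on I c \<longleftrightarrow> (\<forall>s\<in>I. \<forall>t\<in>I. dist (c s) (c t) = \<bar>s - t\<bar>)"

definition geodesic_metric :: "'a::metric_space itself \<Rightarrow> bool" where
  "geodesic_metric _ \<longleftrightarrow>
     (\<forall>x y::'a. \<exists>c. isometric_on {0..dist x y} c \<and> c 0 = x \<and> c (dist x y) = y)"

definition geodesic_segment :: "'a::metric_space \<Rightarrow> 'a \<Rightarrow> 'a set \<Rightarrow> bool" where
  "geodesic_segment x y S \<longleftrightarrow>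
     (\<exists>c. isometric_on {0..dist x y} c \<and> c 0 = x \<and> c (dist x y) = y \<and> S = c ` {0..dist x y})"

text \<open>\<open>\<delta>\<close>-hyperbolicity in the sense of slim geodesic triangles. The quantification over all
  vertices makes it enough to constrain one side of the triangle.\<close>

definition hyperbolic_metric :: "real \<Rightarrow> 'a::metric_space itself \<Rightarrow> bool" where
  "hyperbolic_metric \<delta> _ \<longleftrightarrow>
     (\<forall>(x::'a) y z S1 S2 S3.
        geodesic_segment x y S1 \<longrightarrow> geodesic_segment y z S2 \<longrightarrow> geodesic_segment z x S3 \<longrightarrow>
        (\<forall>u\<in>S1. \<exists>v\<in>S2 \<union> S3. dist u v \<le> \<delta>))"

definition quasi_isometry :: "('b::metric_space \<Rightarrow> 'a::metric_space) \<Rightarrow> bool" where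
  "quasi_isometry g \<longleftrightarrow>
     (\<exists>k\<ge>1. \<exists>\<epsilon>\<ge>0. \<forall>x y. dist x y / k - \<epsilon> \<le> dist (g x) (g y) \<and> dist (g x) (g y) \<le> k * dist x y + \<epsilon>) \<and>
     (\<exists>K\<ge>0. \<forall>z. \<exists>x. dist z (g x) \<le> K)"

definition quasi_inverse ::
  "('b::metric_space \<Rightarrow> 'a::metric_space) \<Rightarrow> ('a \<Rightarrow> 'b) \<Rightarrow> bool" where
  "quasi_inverse g h \<longleftrightarrow> quasi_isometry h \<and>
     (\<exists>K\<ge>0. (\<forall>x. dist (g (h x)) x \<le> K) \<and> (\<forall>y. dist (h (g y)) y \<le> K))"

section \<open>The Gromov boundary and the hyperbolic compactification\<close>

text \<open>Rays are represented by functions on all of \<open>real\<close>; their values at negative arguments are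
  irrelevant, also for the asymptoticity relation, and hence are forgotten in the boundary.\<close>

definition geodesic_ray :: "(real \<Rightarrow> 'a::metric_space) \<Rightarrow> bool" where
  "geodesic_ray c \<longleftrightarrow> isometric_on {0..} c"

definition asymptotic_rel :: "((real \<Rightarrow> 'a::metric_space) \<times> (real \<Rightarrow> 'a)) set" where
  "asymptotic_rel = {(c, c'). geodesic_ray c \<and> geodesic_ray c' \<and>
     (\<exists>K. \<forall>t\<ge>0. dist (c t) (c' t) \<le> K)}"

definition gromov_boundary :: "(real \<Rightarrow> 'a::metric_space) set set" where
  "gromov_boundary = {c. geodesic_ray c} // asymptotic_rel"

definition hyp_points :: "('a::metric_space + (real \<Rightarrow> 'a) set) set" where
  "hyp_points = UNIV <+> gromov_boundary"

text \<open>\<open>generalized_ray p c x\<close>: \<open>c\<close> is a generalized ray from \<open>p\<close> with endpoint \<open>c(\<infinity>) = x\<close>, i.e.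
  a geodesic segment from \<open>p\<close> to \<open>x\<close> prolonged by the constant \<open>x\<close>, or a geodesic ray
  in the class \<open>x\<close>.\<close>

definition generalized_ray ::
  "'a::metric_space \<Rightarrow> (real \<Rightarrow> 'a) \<Rightarrow> 'a + (real \<Rightarrow> 'a) set \<Rightarrow> bool" where
  "generalized_ray p c x \<longleftrightarrow> c 0 = p \<and>
     (case x of
        Inl y \<Rightarrow> \<exists>R\<ge>0. isometric_on {0..R} c \<and> (\<forall>t\<ge>R. c t = y)
      | Inr \<xi> \<Rightarrow> \<xi> \<in> gromov_boundary \<and> c \<in> \<xi>)"

text \<open>Convergence of sequences and the topology of the compactification with respect to a base
  point \<open>p\<close>, following Bridson and Haefliger, \<^emph>\<open>Metric Spaces of Non-Positive Curvature\<close>,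
  Definition III.H.3.5.\<close>

definition hyp_converges ::
  "'a::metric_space \<Rightarrow> (nat \<Rightarrow> 'a + (real \<Rightarrow> 'a) set) \<Rightarrow> 'a + (real \<Rightarrow> 'a) set \<Rightarrow> bool" where
  "hyp_converges p x l \<longleftrightarrow>
     (\<exists>c. (\<forall>n. generalized_ray p (c n) (x n)) \<and>
        (\<forall>r::nat \<Rightarrow> nat. strict_mono r \<longrightarrow>
           (\<exists>s c'. strict_mono (s::nat \<Rightarrow> nat) \<and> generalized_ray p c' l \<and>
              (\<forall>K. compact K \<longrightarrow> K \<subseteq> {0..} \<longrightarrow>
                 uniform_limit K (\<lambda>n. c (r (s n))) c' sequentially))))"

definition hyp_closed :: "'a::metric_space \<Rightarrow> ('a + (real \<Rightarrow> 'a) set) set \<Rightarrow> bool" where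
  "hyp_closed p B \<longleftrightarrow> B \<subseteq> hyp_points \<and>
     (\<forall>x l. (\<forall>n. x n \<in> B) \<longrightarrow> l \<in> hyp_points \<longrightarrow> hyp_converges p x l \<longrightarrow> l \<in> B)"

definition hyperbolic_compactification ::
  "'a::metric_space \<Rightarrow> ('a + (real \<Rightarrow> 'a) set) topology" where
  "hyperbolic_compactification p =
     topology (\<lambda>U. U \<subseteq> hyp_points \<and> hyp_closed p (hyp_points - U))"

section \<open>Well-definedness\<close>

lemma topology_by_closed:
  fixes P :: "'a set \<Rightarrow> bool"
  assumes empty: "P {}" and whole: "P S"
    and un: "\<And>A B. A \<subseteq> S \<Longrightarrow> B \<subseteq> S \<Longrightarrow> P A \<Longrightarrow> P B \<Longrightarrow> P (A \<union> B)"
    and int: "\<And>\<A>. \<A> \<noteq> {} \<Longrightarrow> (\<And>A. A \<in> \<A> \<Longrightarrow> A \<subseteq> S \<and> P A) \<Longrightarrow> P (\<Inter>\<A>)"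
  defines "T \<equiv> topology (\<lambda>U. U \<subseteq> S \<and> P (S - U))"
  shows "topspace T = S" and "closedin T C \<longleftrightarrow> C \<subseteq> S \<and> P C"
proof -
  have ist: "istopology (\<lambda>U. U \<subseteq> S \<and> P (S - U))"
    unfolding istopology_def
  proof (intro conjI allI impI)
    fix U V assume "U \<subseteq> S \<and> P (S - U)" "V \<subseteq> S \<and> P (S - V)"
    then show "U \<inter> V \<subseteq> S" "P (S - U \<inter> V)"
      using un[of "S - U" "S - V"] by (auto simp: Diff_Int)
  next
    fix \<K> assume K: "\<forall>U\<in>\<K>. U \<subseteq> S \<and> P (S - U)"
    then show "\<Union>\<K> \<subseteq> S" by auto
    show "P (S - \<Union>\<K>)"
    proof (cases "\<K> = {}")
      case True then show ?thesis using whole by simp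
    next
      case False
      then have "S - \<Union>\<K> = \<Inter>((\<lambda>U. S - U) ` \<K>)" by auto
      then show ?thesis using int[of "(\<lambda>U. S - U) ` \<K>"] K False by auto
    qed
  qed
  then have op: "openin T U \<longleftrightarrow> U \<subseteq> S \<and> P (S - U)" for U
    unfolding T_def by (simp add: topology_inverse')
  show tT: "topspace T = S"
  proof
    show "topspace T \<subseteq> S" using op[of "topspace T"] by simp
    show "S \<subseteq> topspace T" using op[of S] empty by (simp add: openin_subset)
  qed
  show "closedin T C \<longleftrightarrow> C \<subseteq> S \<and> P C"
    unfolding closedin_def tT op by (auto simp: double_diff)
qed

lemma admissible_mono:
  assumes "admissible X W f" "closedin X A" "closedin X B" "A \<subseteq> B"
  shows "f A \<subseteq> f B"
  using assms unfolding admissible_def by (metis Un_absorb1 Un_upper1)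

lemma
  assumes adm: "admissible X W f"
  shows topspace_glue: "topspace (glue X W f) = topspace X <+> topspace W"
    and closedin_glue: "closedin (glue X W f) C \<longleftrightarrow> glue_closed X W f C"
proof -
  let ?S = "topspace X <+> topspace W"
  have vS: "Inl -` ?S = topspace X" "Inr -` ?S = topspace W" by auto
  have 1: "glue_closed X W f {}"
    using adm by (auto simp: glue_closed_def admissible_def)
  have 2: "glue_closed X W f ?S"
    using adm unfolding glue_closed_def vS admissible_def
    by (auto dest: closedin_subset)
  have 3: "glue_closed X W f (A \<union> B)" if "glue_closed X W f A" "glue_closed X W f B" for A B
    using adm that unfolding glue_closed_def admissible_def vimage_Un by (auto intro!: closedin_Un)
  have 4: "glue_closed X W f (\<Inter>\<A>)"
    if ne: "\<A> \<noteq> {}" and cl: "\<And>A. A \<in> \<A> \<Longrightarrow> A \<subseteq> ?S \<and> glue_closed X W f A" for \<A>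
  proof -
    have v: "Inl -` \<Inter>\<A> = \<Inter>((\<lambda>A. Inl -` A) ` \<A>)" "Inr -` \<Inter>\<A> = \<Inter>((\<lambda>A. Inr -` A) ` \<A>)" by auto
    have a: "closedin X (Inl -` \<Inter>\<A>)" and b: "closedin W (Inr -` \<Inter>\<A>)"
      unfolding v using ne cl by (auto simp: glue_closed_def intro!: closedin_Inter)
    have "f (Inl -` \<Inter>\<A>) \<subseteq> Inr -` A" if "A \<in> \<A>" for A
      using admissible_mono[OF adm a, of "Inl -` A"] cl[OF that] that
      by (fastforce simp: glue_closed_def)
    then show ?thesis using a b by (auto simp: glue_closed_def)
  qed
  show "topspace (glue X W f) = ?S"
    unfolding glue_def by (rule topology_by_closed) (use 1 2 3 4 in auto)
  have "closedin (glue X W f) C \<longleftrightarrow> C \<subseteq> ?S \<and> glue_closed X W f C"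
    unfolding glue_def by (rule topology_by_closed) (use 1 2 3 4 in auto)
  moreover have "C \<subseteq> ?S" if "glue_closed X W f C"
  proof
    fix x assume "x \<in> C"
    with that show "x \<in> ?S"
      by (cases x) (auto simp: glue_closed_def dest: closedin_subset)
  qed
  ultimately show "closedin (glue X W f) C \<longleftrightarrow> glue_closed X W f C" by blast
qed

lemma topspace_remainder: "topspace (remainder T) = Inr -` topspace T"
  by (auto simp: remainder_def topspace_pullback_topology)

lemma openin_remainder: "openin (remainder T) V \<longleftrightarrow> (\<exists>U. openin T U \<and> V = Inr -` U)"
  by (auto simp: remainder_def openin_pullback_topology)

lemma closedin_remainder: "closedin (remainder T) D \<longleftrightarrow> (\<exists>C. closedin T C \<and> D = Inr -` C)"
proof
  assume "closedin (remainder T) D"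
  then obtain U where "D \<subseteq> Inr -` topspace T" "openin T U" "Inr -` topspace T - D = Inr -` U"
    unfolding closedin_def topspace_remainder openin_remainder by auto
  then have "closedin T (topspace T - U)" "D = Inr -` (topspace T - U)" by auto
  then show "\<exists>C. closedin T C \<and> D = Inr -` C" by blast
next
  assume "\<exists>C. closedin T C \<and> D = Inr -` C"
  then obtain C where C: "closedin T C" "D = Inr -` C" by blast
  then have "Inr -` topspace T - D = Inr -` (topspace T - C)" "openin T (topspace T - C)"
    by auto
  then show "closedin (remainder T) D"
    unfolding closedin_def topspace_remainder openin_remainder
    using C closedin_subset by blast
qed

lemma admissible_pullback_attaching:
  "admissible euclidean (remainder T) (pullback_map \<pi> (attaching_map T))"
  unfolding admissible_def pullback_map_def attaching_map_def closedin_remainder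
  by (auto simp: image_Un closure_of_Un intro: closedin_closure_of)

lemma attaching_map_glue:
  assumes adm: "admissible X W f" and A: "closedin X A"
  shows "attaching_map (glue X W f) A = f A"
proof -
  have AX: "A \<subseteq> topspace X" and fA: "closedin W (f A)"
    using A adm closedin_subset by (auto simp: admissible_def)
  have "glue X W f closure_of (Inl ` A) = Inl ` A \<union> Inr ` f A" (is "_ = ?C")
  proof (rule closure_of_unique)
    show "Inl ` A \<subseteq> ?C" by simp
    have v: "Inl -` ?C = A" "Inr -` ?C = f A" by auto
    show "closedin (glue X W f) ?C"
      unfolding closedin_glue[OF adm] glue_closed_def v using A fA by simp
    fix D assume "Inl ` A \<subseteq> D" "closedin (glue X W f) D"
    then have D: "A \<subseteq> Inl -` D" "closedin X (Inl -` D)" "f (Inl -` D) \<subseteq> Inr -` D" "Inl ` A \<subseteq> D"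
      by (auto simp: closedin_glue[OF adm] glue_closed_def)
    from admissible_mono[OF adm A D(2) D(1)] D show "?C \<subseteq> D" by auto
  qed
  then show ?thesis by (auto simp: attaching_map_def)
qed

lemma remainder_glue:
  fixes X :: "'a topology" and W :: "'b topology"
  assumes adm: "admissible X W f"
  shows "remainder (glue X W f) = W"
proof (rule topology_eq[THEN iffD2], intro allI)
  have cl: "closedin (remainder (glue X W f)) D \<longleftrightarrow> closedin W D" for D
  proof
    assume D: "closedin W D"
    have v: "Inl -` (Inr ` D :: ('a + 'b) set) = {}" "Inr -` (Inr ` D :: ('a + 'b) set) = D"
      by auto
    have "closedin (glue X W f) (Inr ` D)"
      using D adm unfolding closedin_glue[OF adm] glue_closed_def admissible_def v by simp
    then show "closedin (remainder (glue X W f)) D"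
      unfolding closedin_remainder using v(2) by metis
  qed (auto simp: closedin_remainder closedin_glue[OF adm] glue_closed_def)
  have ts: "topspace (remainder (glue X W f)) = topspace W"
    by (auto simp: topspace_remainder topspace_glue[OF adm])
  show "openin (remainder (glue X W f)) V \<longleftrightarrow> openin W V" for V
    unfolding openin_closedin_eq cl ts ..
qed

lemma Pi_functor_glue:
  fixes \<pi> :: "'b::topological_space \<Rightarrow> 'a::topological_space"
  assumes adm: "admissible euclidean W f"
  shows "Pi_functor \<pi> (glue euclidean W f) = glue euclidean W (pullback_map \<pi> f)"
proof -
  have "pullback_map \<pi> (attaching_map (glue euclidean W f)) = pullback_map \<pi> f"
    by (auto simp: fun_eq_iff pullback_map_def attaching_map_glue[OF adm])
  then show ?thesis by (simp add: Pi_functor_def remainder_glue[OF adm])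
qed

text \<open>A topology on the disjoint union inducing the given topology on its open part \<open>X\<close> is of the
  form \<open>X +\<^sub>f W\<close> with \<open>f(A) = Cl(A) - X\<close>.\<close>

lemma glue_attaching_map:
  fixes T :: "('a + 'w) topology"
  assumes sub: "pullback_topology UNIV Inl T = X" and op: "openin T (Inl ` topspace X)"
  shows "glue X (remainder T) (attaching_map T) = T"
proof -
  have opX: "openin X V \<longleftrightarrow> (\<exists>U. openin T U \<and> V = Inl -` U)" for V
    unfolding sub[symmetric] by (auto simp: openin_pullback_topology)
  have tsX: "topspace X = Inl -` topspace T"
    unfolding sub[symmetric] by (auto simp: topspace_pullback_topology)
  have adm: "admissible X (remainder T) (attaching_map T)"
    unfolding admissible_def attaching_map_def closedin_remainder
    by (auto simp: image_Un closure_of_Un intro: closedin_closure_of)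
  have ts: "topspace (glue X (remainder T) (attaching_map T)) = topspace T"
  proof (rule set_eqI)
    fix x show "x \<in> topspace (glue X (remainder T) (attaching_map T)) \<longleftrightarrow> x \<in> topspace T"
      unfolding topspace_glue[OF adm] tsX topspace_remainder by (cases x) auto
  qed
  have "glue_closed X (remainder T) (attaching_map T) C \<longleftrightarrow> closedin T C" for C
  proof
    assume C: "closedin T C"
    have "openin X (topspace X - Inl -` C)"
      unfolding opX tsX using C by (intro exI[of _ "topspace T - C"]) auto
    moreover have "T closure_of (Inl ` (Inl -` C)) \<subseteq> C"
      using C by (intro closure_of_minimal) auto
    ultimately show "glue_closed X (remainder T) (attaching_map T) C"
      using C closedin_subset[OF C]
      by (auto simp: glue_closed_def closedin_def[of X] tsX closedin_remainder attaching_map_def)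
  next
    assume g: "glue_closed X (remainder T) (attaching_map T) C"
    then obtain U where U: "openin T U" "topspace X - Inl -` C = Inl -` U"
      unfolding glue_closed_def closedin_def[of X] opX by auto
    from g obtain D where D: "closedin T D" "Inr -` C = Inr -` D"
      by (auto simp: glue_closed_def closedin_remainder)
    from g have CX: "Inl -` C \<subseteq> topspace X" by (auto simp: glue_closed_def dest: closedin_subset)
    have V: "openin T (Inl ` topspace X \<inter> U)" using op U by blast
    let ?E = "T closure_of (Inl ` (Inl -` C))"
    have Er: "Inr -` ?E \<subseteq> Inr -` C" using g by (simp add: glue_closed_def attaching_map_def)
    have El: "Inl -` ?E \<subseteq> Inl -` C"
    proof
      fix a assume "a \<in> Inl -` ?E"
      then have a: "Inl a \<in> ?E" by simp
      show "a \<in> Inl -` C"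
      proof (rule ccontr)
        assume na: "a \<notin> Inl -` C"
        have "a \<in> topspace X" using a tsX closure_of_subset_topspace[of T] by auto
        then have "Inl a \<in> Inl ` topspace X \<inter> U" using na U by blast
        then obtain b where "b \<in> Inl ` (Inl -` C)" "b \<in> Inl ` topspace X \<inter> U"
          using a V unfolding in_closure_of by meson
        then obtain b' where "b' \<in> Inl -` C" "b' \<in> Inl -` U" by auto
        then show False using U(2) by blast
      qed
    qed
    have E: "Inl ` (Inl -` C) \<subseteq> ?E"
      using CX tsX by (intro closure_of_subset) auto
    have F: "closedin T (D - Inl ` topspace X)"
      using D op by (simp add: closedin_diff)
    have "C = ?E \<union> (D - Inl ` topspace X)"
    proof (rule set_eqI)
      fix x show "x \<in> C \<longleftrightarrow> x \<in> ?E \<union> (D - Inl ` topspace X)"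
      proof (cases x)
        case (Inl a)
        then show ?thesis using El E closedin_subset[OF D(1)] tsX by auto
      next
        case (Inr w)
        then show ?thesis using Er D(2) by auto
      qed
    qed
    then show "closedin T C" using F by (metis closedin_Un closedin_closure_of)
  qed
  then have "closedin (glue X (remainder T) (attaching_map T)) C \<longleftrightarrow> closedin T C" for C
    by (simp add: closedin_glue[OF adm])
  then show ?thesis by (simp add: topology_eq openin_closedin_eq ts)
qed

lemma hyp_converges_subseq:
  assumes "hyp_converges p x l" "strict_mono r"
  shows "hyp_converges p (x \<circ> r) l"
proof -
  obtain c where c: "\<And>n. generalized_ray p (c n) (x n)"
    "\<And>r::nat \<Rightarrow> nat. strict_mono r \<Longrightarrow>
           (\<exists>s c'. strict_mono (s::nat \<Rightarrow> nat) \<and> generalized_ray p c' l \<and>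
              (\<forall>K. compact K \<longrightarrow> K \<subseteq> {0..} \<longrightarrow>
                 uniform_limit K (\<lambda>n. c (r (s n))) c' sequentially))"
    using assms(1) unfolding hyp_converges_def by blast
  show ?thesis unfolding hyp_converges_def
  proof (intro exI[of _ "c \<circ> r"] conjI allI impI)
    show "generalized_ray p ((c \<circ> r) n) ((x \<circ> r) n)" for n using c(1) by simp
    fix q :: "nat \<Rightarrow> nat" assume "strict_mono q"
    then have "strict_mono (r \<circ> q)" using assms(2) strict_mono_o by blast
    from c(2)[OF this] show "\<exists>s c'. strict_mono (s::nat \<Rightarrow> nat) \<and> generalized_ray p c' l \<and>
              (\<forall>K. compact K \<longrightarrow> K \<subseteq> {0..} \<longrightarrow>
                 uniform_limit K (\<lambda>n. (c \<circ> r) (q (s n))) c' sequentially)"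
      by simp
  qed
qed

lemma
  shows topspace_hyperbolic_compactification:
      "topspace (hyperbolic_compactification p) = hyp_points"
    and closedin_hyperbolic_compactification:
      "closedin (hyperbolic_compactification p) B \<longleftrightarrow> hyp_closed p B"
proof -
  have 3: "hyp_closed p (A \<union> B)" if A: "hyp_closed p A" and B: "hyp_closed p B" for A B
    unfolding hyp_closed_def
  proof (intro conjI allI impI)
    show "A \<union> B \<subseteq> hyp_points" using A B by (auto simp: hyp_closed_def)
    fix x l assume x: "\<forall>n. x n \<in> A \<union> B" and l: "l \<in> hyp_points" "hyp_converges p x l"
    have "infinite {n. x n \<in> A} \<or> infinite {n. x n \<in> B}"
    proof -
      have "{n. x n \<in> A} \<union> {n. x n \<in> B} = UNIV" using x by auto
      then show ?thesis by (metis finite_Un infinite_UNIV_nat)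
    qed
    moreover have "l \<in> D" if inf: "infinite {n. x n \<in> D}" and D: "hyp_closed p D" for D
    proof -
      obtain r :: "nat \<Rightarrow> nat" where "strict_mono r" "\<forall>n. r n \<in> {n. x n \<in> D}"
        using infinite_enumerate[OF inf] by metis
      then have "\<forall>n. (x \<circ> r) n \<in> D" "hyp_converges p (x \<circ> r) l"
        using hyp_converges_subseq[OF l(2)] by auto
      then show ?thesis
        using D l(1) unfolding hyp_closed_def by blast
    qed
    ultimately show "l \<in> A \<union> B" using A B by blast
  qed
  have 4: "hyp_closed p (\<Inter>\<A>)" if "\<A> \<noteq> {}" "\<And>A. A \<in> \<A> \<Longrightarrow> A \<subseteq> hyp_points \<and> hyp_closed p A" for \<A>
    unfolding hyp_closed_def
  proof (intro conjI allI impI)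
    show "\<Inter>\<A> \<subseteq> hyp_points" using that by blast
    fix x l assume "\<forall>n. x n \<in> \<Inter>\<A>" "l \<in> hyp_points" "hyp_converges p x l"
    then show "l \<in> \<Inter>\<A>" using that(2) unfolding hyp_closed_def by blast
  qed
  have 12: "hyp_closed p {}" "hyp_closed p hyp_points" by (auto simp: hyp_closed_def)
  show "topspace (hyperbolic_compactification p) = hyp_points"
    unfolding hyperbolic_compactification_def
    by (rule topology_by_closed) (use 12 3 4 in auto)
  have "closedin (hyperbolic_compactification p) B \<longleftrightarrow> B \<subseteq> hyp_points \<and> hyp_closed p B"
    unfolding hyperbolic_compactification_def
    by (rule topology_by_closed) (use 12 3 4 in auto)
  then show "closedin (hyperbolic_compactification p) B \<longleftrightarrow> hyp_closed p B"
    by (auto simp: hyp_closed_def)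
qed

end

theory Submission
  imports Defs "HOL-Library.Diagonal_Subsequence"
begin

text \<open>A sequence converges to a boundary point exactly when the geodesics from its members to points
  far out on a representing ray leave every ball. For two pairs of points, the condition that all
  geodesics between them avoid a large ball is preserved by quasi-isometries up to a change of the
  radius: this only needs the easy half of the Morse lemma, that a geodesic stays close to any
  quasigeodesic with the same endpoints. Hence \<open>\<pi>\<close> induces a
  bijection of the boundaries which respects convergence to boundary points. A set is closed in the
  compactification iff its finite part is closed and it contains all limits in the boundary of
  sequences in either part, so the closed sets correspond as well.\<close>

text \<open>The map \<open>\<pi>\<close> may be discontinuous, so nothing can be transported about
  convergence to finite points. Only limits in the boundary are compared; on the finite part the
  homeomorphism is the identity of \<open>Y\<close>, and there both spaces impose the same
  closedness condition. With only one half of the Morse lemma at hand, the image of a ray is not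
  known to run near a ray. Its endpoint is therefore constructed afresh: the segments from a base
  point to the points of the image subconverge by Arzela-Ascoli, and thin triangles show that the
  limit ray has the right endpoint. The compactification is topologized by sequences, and it is not
  clear that the limits of sequences in \<open>A\<close> already make up all of
  \<open>f(A) = Cl(A) - X\<close>. The closed sets of a glued space depend only on whether
  \<open>f(A) \<subseteq> D\<close> for closed \<open>D\<close>, and this relation can be tested on
  limits of sequences in \<open>A\<close>.\<close>

section \<open>Slim triangles and geodesics avoiding balls\<close>

text \<open>In a geodesic space \<open>btw x u y\<close> says that \<open>u\<close> lies on some geodesic segment from \<open>x\<close> to \<open>y\<close>;
  working with it avoids handling parametrized segments.\<close>

definition btw :: "'a::metric_space \<Rightarrow> 'a \<Rightarrow> 'a \<Rightarrow> bool" where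
  "btw x u y \<longleftrightarrow> dist x u + dist u y = dist x y"

lemma btw_sym: "btw x u y \<longleftrightarrow> btw y u x"
  by (simp add: btw_def dist_commute add.commute)

lemma btw_ends [simp]: "btw x x y" "btw x y y"
  by (auto simp: btw_def)

lemma btw_self [simp]: "btw x u x \<longleftrightarrow> u = x"
  by (auto simp: btw_def dist_commute)

text \<open>Up to an additive constant depending on \<delta>, this is the bound
  \<open>M \<le> (x|y)\<^sub>p\<close> on the Gromov product. A quasi-isometry does not control the
  differences of distances in that product, but it does control geodesics, whence this form.\<close>

definition far :: "'a::metric_space \<Rightarrow> real \<Rightarrow> 'a \<Rightarrow> 'a \<Rightarrow> bool" where
  "far p M x y \<longleftrightarrow> (\<forall>u. btw x u y \<longrightarrow> M \<le> dist p u)"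

lemma far_sym: "far p M x y \<longleftrightarrow> far p M y x"
  by (simp add: far_def btw_sym)

lemma far_mono: "far p M x y \<Longrightarrow> M' \<le> M \<Longrightarrow> far p M' x y"
  unfolding far_def by force

lemma far_base:
  assumes "far p M x y" shows "far p' (M - dist p p') x y"
  unfolding far_def
proof (intro allI impI)
  fix u assume "btw x u y"
  then have "M \<le> dist p u" using assms by (simp add: far_def)
  then show "M - dist p p' \<le> dist p' u" using dist_triangle[of p u p'] by linarith
qed

lemma far_left: "far p M x y \<Longrightarrow> M \<le> dist p x"
  and far_right: "far p M x y \<Longrightarrow> M \<le> dist p y"
  by (auto simp: far_def)

lemma far_near:
  assumes "dist x y \<le> K" "M + K \<le> dist p x"
  shows "far p M x y"
  unfolding far_def
proof (intro allI impI)
  fix u assume "btw x u y"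
  then have "dist x u \<le> K" using assms(1) zero_le_dist[of u y] unfolding btw_def by linarith
  then show "M \<le> dist p u" using assms(2) dist_triangle[of p x u] dist_commute[of x u] by linarith
qed

text \<open>A point beyond \<open>w\<close> but closer to \<open>p\<close> than \<open>w\<close>
  would give a shortcut from \<open>p\<close> to \<open>x\<close>.\<close>

lemma far_btw:
  assumes "btw p w x"
  shows "far p (dist p w) w x"
  unfolding far_def
proof (intro allI impI)
  fix u assume "btw w u x"
  then show "dist p w \<le> dist p u"
    using assms dist_triangle[of p x u] zero_le_dist[of w u] dist_commute[of x u]
    unfolding btw_def by linarith
qed

text \<open>The two indices run independently, so that a constant sequence can stand for a finite
  point and an unbounded one for a boundary point. The radius stays a parameter because convergence
  of a sequence of such points needs a bound for each member.\<close>

definition far_seq :: "'a::metric_space \<Rightarrow> real \<Rightarrow> (nat \<Rightarrow> 'a) \<Rightarrow> (nat \<Rightarrow> 'a) \<Rightarrow> bool" where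
  "far_seq p M a b \<longleftrightarrow> (\<exists>T. \<forall>s\<ge>T. \<forall>t\<ge>T. far p M (a s) (b t))"

lemma far_seq_sym: "far_seq p M a b \<Longrightarrow> far_seq p M b a"
  unfolding far_seq_def by (metis far_sym)

lemma far_seq_mono: "far_seq p M a b \<Longrightarrow> M' \<le> M \<Longrightarrow> far_seq p M' a b"
  unfolding far_seq_def by (metis far_mono)

lemma far_seq_base: "far_seq p M a b \<Longrightarrow> far_seq p' (M - dist p p') a b"
  unfolding far_seq_def by (metis far_base)

lemma far_seq_cong:
  assumes "far_seq p M a b" "\<forall>s\<ge>T. a s = x" "\<forall>s\<ge>T'. a' s = x"
  shows "far_seq p M a' b"
proof -
  obtain U where "\<forall>s\<ge>U. \<forall>t\<ge>U. far p M (a s) (b t)" using assms(1) by (auto simp: far_seq_def)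
  then have "\<forall>s\<ge>max U (max T T'). \<forall>t\<ge>max U (max T T'). far p M (a' s) (b t)"
    using assms by (metis max.bounded_iff order_refl)
  then show ?thesis unfolding far_seq_def by blast
qed

text \<open>Gromov's equivalence of sequences converging at infinity: the products of their members
  tend to infinity. The relation is not reflexive; \<open>seq_equiv a a\<close> says that
  \<open>a\<close> is a Gromov sequence.\<close>

definition seq_equiv :: "(nat \<Rightarrow> 'a::metric_space) \<Rightarrow> (nat \<Rightarrow> 'a) \<Rightarrow> bool" where
  "seq_equiv a b \<longleftrightarrow> (\<forall>p M. far_seq p M a b)"

lemma seq_equivI:
  assumes "\<And>M. far_seq p M a b" shows "seq_equiv a b"
  unfolding seq_equiv_def
proof (intro allI)
  fix p' M
  have "far_seq p' (M + dist p p' - dist p p') a b"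
    by (rule far_seq_base) (rule assms)
  then show "far_seq p' M a b" by simp
qed

lemma seq_equiv_sym: "seq_equiv a b \<Longrightarrow> seq_equiv b a"
  by (auto simp: seq_equiv_def intro: far_seq_sym)

locale geodesic_hyperbolic =
  fixes \<delta> :: real and sp :: "'a::metric_space itself"
  assumes geod: "geodesic_metric sp" and hyp: "hyperbolic_metric \<delta> sp"
begin

lemma geodesic: obtains c where "isometric_on {0..dist x y} c" "c 0 = (x::'a)" "c (dist x y) = y"
  using geod unfolding geodesic_metric_def by blast

lemma geodesic_point:
  assumes "0 \<le> t" "t \<le> dist x y"
  obtains u :: 'a where "btw x u y" "dist x u = t"
proof -
  obtain c where c: "isometric_on {0..dist x y} c" "c 0 = x" "c (dist x y) = y" by (rule geodesic)
  have "dist (c 0) (c t) = t" "dist (c t) (c (dist x y)) = dist x y - t"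
    using c(1) assms unfolding isometric_on_def by auto
  then show thesis using that[of "c t"] c by (simp add: btw_def)
qed

lemma segment_exists: obtains S where "geodesic_segment (x::'a) y S"
  using geodesic[of x y] unfolding geodesic_segment_def by metis

lemma segment_btw:
  assumes "geodesic_segment (x::'a) y S" "v \<in> S" shows "btw x v y"
proof -
  obtain c t where c: "isometric_on {0..dist x y} c" "c 0 = x" "c (dist x y) = y"
    and t: "v = c t" "0 \<le> t" "t \<le> dist x y"
    using assms unfolding geodesic_segment_def by auto
  have "dist (c 0) (c t) = t" "dist (c t) (c (dist x y)) = dist x y - t"
    using c(1) t unfolding isometric_on_def by auto
  then show ?thesis using c t by (simp add: btw_def)
qed

text \<open>A geodesic to \<open>u\<close> followed by one from \<open>u\<close> is a geodesic as
  soon as the distances add up. This makes slimness, which speaks of segments, available for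
  \<open>btw\<close>.\<close>

lemma btw_segment:
  assumes "btw (x::'a) u y"
  obtains S where "geodesic_segment x y S" "u \<in> S"
proof -
  let ?a = "dist x u"
  obtain c1 where c1: "isometric_on {0..?a} c1" "c1 0 = x" "c1 ?a = u" by (rule geodesic)
  obtain c2 where c2: "isometric_on {0..dist u y} c2" "c2 0 = u" "c2 (dist u y) = y" by (rule geodesic)
  define c where "c t = (if t \<le> ?a then c1 t else c2 (t - ?a))" for t
  have xy: "dist x y = ?a + dist u y" using assms by (simp add: btw_def)
  \<comment> \<open>The path through \<open>u\<close> bounds the distance from above; a smaller
    distance would bring \<open>x\<close> and \<open>y\<close> closer together than they
    are.\<close>
  have cross: "dist (c s) (c t) = t - s" if "0 \<le> s" "s \<le> ?a" "?a < t" "t \<le> dist x y" for s t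
  proof -
    have cs: "c s = c1 s" "c t = c2 (t - ?a)" using that by (auto simp: c_def)
    have 1: "dist (c1 0) (c1 s) = s" "dist (c1 s) (c1 ?a) = ?a - s"
      using c1(1) that unfolding isometric_on_def by auto
    have 2: "dist (c2 0) (c2 (t - ?a)) = t - ?a" "dist (c2 (t - ?a)) (c2 (dist u y)) = dist x y - t"
      using c2(1) that xy unfolding isometric_on_def by auto
    have "dist (c s) (c t) \<le> t - s"
      using 1 2 cs c1 c2 dist_triangle[of "c s" "c t" u] by simp
    moreover have "dist x y \<le> s + dist (c s) (c t) + (dist x y - t)"
      using 1 2 cs c1 c2 dist_triangle[of x y "c s"] dist_triangle[of "c s" y "c t"] by simp
    ultimately show ?thesis by simp
  qed
  have "isometric_on {0..dist x y} c"
    unfolding isometric_on_def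
  proof (intro ballI)
    fix s t assume st: "s \<in> {0..dist x y}" "t \<in> {0..dist x y}"
    consider "s \<le> ?a" "t \<le> ?a" | "s \<le> ?a" "?a < t" | "?a < s" "t \<le> ?a" | "?a < s" "?a < t"
      by linarith
    then show "dist (c s) (c t) = \<bar>s - t\<bar>"
    proof cases
      case 1 then show ?thesis using c1(1) st by (simp add: c_def isometric_on_def)
    next
      case 2 then show ?thesis using cross[of s t] st by simp
    next
      case 3 then show ?thesis using cross[of t s] st by (simp add: dist_commute)
    next
      case 4
      then have "dist (c s) (c t) = \<bar>(s - ?a) - (t - ?a)\<bar>"
        using c2(1) st xy unfolding c_def isometric_on_def by auto
      then show ?thesis by simp
    qed
  qed
  moreover have "c 0 = x" using c1 by (simp add: c_def)
  moreover have "c (dist x y) = y"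
  proof (cases "u = y")
    case True
    then show ?thesis using c1(3) by (simp add: c_def)
  next
    case False
    then have "\<not> dist x y \<le> ?a" "dist x y - ?a = dist u y" using xy by auto
    then show ?thesis using c2(3) by (simp add: c_def)
  qed
  moreover have "u \<in> c ` {0..dist x y}"
  proof (rule image_eqI)
    show "u = c ?a" using c1(3) by (simp add: c_def)
    show "?a \<in> {0..dist x y}" unfolding xy by simp
  qed
  ultimately show thesis using that[of "c ` {0..dist x y}"] unfolding geodesic_segment_def by blast
qed

lemma slim:
  assumes "btw (x::'a) u y"
  obtains v where "btw y v z \<or> btw z v x" "dist u v \<le> \<delta>"
proof -
  obtain S1 where "geodesic_segment x y S1" "u \<in> S1" using assms by (rule btw_segment)
  moreover obtain S2 where S2: "geodesic_segment y z S2" by (rule segment_exists)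
  moreover obtain S3 where S3: "geodesic_segment z x S3" by (rule segment_exists)
  ultimately obtain v where "v \<in> S2 \<union> S3" "dist u v \<le> \<delta>"
    using hyp unfolding hyperbolic_metric_def by blast
  then show thesis using that S2 S3 segment_btw by blast
qed

lemma delta_nonneg: "0 \<le> \<delta>"
proof -
  obtain v :: 'a where "dist undefined v \<le> \<delta>" using slim[of undefined undefined undefined] by auto
  then show ?thesis using zero_le_dist[of undefined v] by linarith
qed

text \<open>This is the ultrametric inequality for Gromov products: each point of the third side is
  \<open>\<delta>\<close>-close to one of the other two. Every link of a chain costs one
  \<open>\<delta>\<close>.\<close>

lemma far_trans:
  assumes "far p M x y" "far p M y z"
  shows "far (p::'a) (M - \<delta>) x z"
  unfolding far_def
proof (intro allI impI)
  fix u assume "btw x u z"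
  then obtain v where v: "btw z v y \<or> btw y v x" "dist u v \<le> \<delta>" by (rule slim)
  then have "M \<le> dist p v" using assms by (auto simp: far_def btw_sym)
  then show "M - \<delta> \<le> dist p u" using v dist_triangle[of p v u] by linarith
qed

text \<open>In the triangle \<open>p\<close>, \<open>x\<close>, \<open>w\<close> the two sides at
  \<open>w\<close> together form a geodesic from \<open>p\<close> to \<open>x\<close>, along which
  the position of a point is its distance from \<open>p\<close>.\<close>

lemma bigon:
  assumes "btw (p::'a) v x" "btw p w x"
  shows "dist v w \<le> 2 * \<delta> + \<bar>dist p v - dist p w\<bar>"
proof -
  obtain v' where v': "btw x v' w \<or> btw w v' p" and d: "dist v v' \<le> \<delta>"
    using assms(1) by (rule slim)
  have e: "dist p v + dist v x = dist p x" "dist p w + dist w x = dist p x"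
    using assms by (auto simp: btw_def)
  have "dist v' w \<le> \<delta> + \<bar>dist p v - dist p w\<bar>" using v'
  proof
    assume "btw x v' w"
    then have "dist v' w = dist w x - dist x v'" using dist_commute[of x w] unfolding btw_def by linarith
    then show ?thesis using e d dist_triangle[of v x v'] dist_commute[of x v'] by linarith
  next
    assume "btw w v' p"
    then have "dist v' w = dist p w - dist p v'"
      using dist_commute[of p w] dist_commute[of p v'] dist_commute[of w v'] unfolding btw_def by linarith
    then show ?thesis using e d dist_triangle[of p v v'] dist_commute[of v v'] by linarith
  qed
  then show ?thesis using d dist_triangle[of v w v'] by linarith
qed

text \<open>Geodesics to ends with a large Gromov product run together until that product is
  reached. The quadrilateral \<open>p'\<close>, \<open>x\<close>, \<open>x'\<close>,
  \<open>p\<close> is cut into two slim triangles, and \<open>M\<close> keeps \<open>w\<close> away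
  from the side between \<open>x\<close> and \<open>x'\<close>. The triangles, the resulting shift
  of position and \<open>bigon\<close> contribute \<open>2 * \<delta>\<close> each.\<close>

lemma thin:
  assumes "btw (p'::'a) w x" "btw p w' x'" "far p' M x x'" "dist p' w + \<delta> < M"
  shows "dist w w' \<le> 6 * \<delta> + 3 * dist p p' + \<bar>dist p' w - dist p w'\<bar>"
proof -
  obtain v where v: "btw x v x' \<or> btw x' v p'" "dist w v \<le> \<delta>" using assms(1) by (rule slim)
  have "\<not> btw x v x'"
  proof
    assume "btw x v x'"
    then have "M \<le> dist p' v" using assms(3) by (simp add: far_def)
    then show False using v assms(4) dist_triangle[of p' v w] by linarith
  qed
  with v have "btw x' v p'" by simp
  then obtain v' where v': "btw p' v' p \<or> btw p v' x'" "dist v v' \<le> \<delta>" by (rule slim)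
  \<comment> \<open>If the second triangle leads to the short side between the base points,
    \<open>p\<close> itself serves as \<open>z\<close>, at the cost of the length of that
    side.\<close>
  have "\<exists>z. btw p z x' \<and> dist w z \<le> 2 * \<delta> + dist p p'" using v'(1)
  proof
    assume "btw p' v' p"
    then have "dist v' p \<le> dist p p'"
      using zero_le_dist[of p' v'] dist_commute[of p p'] unfolding btw_def by linarith
    then have "dist w p \<le> 2 * \<delta> + dist p p'"
      using v(2) v'(2) dist_triangle[of w p v] dist_triangle[of v p v'] by linarith
    then show ?thesis by (intro exI[of _ p]) simp
  next
    assume "btw p v' x'"
    moreover have "dist w v' \<le> 2 * \<delta> + dist p p'"
      using v(2) v'(2) dist_triangle[of w v' v] zero_le_dist[of p p'] by linarith
    ultimately show ?thesis by blast
  qed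
  then obtain z where z: "btw p z x'" "dist w z \<le> 2 * \<delta> + dist p p'" by blast
  have "\<bar>dist p z - dist p' w\<bar> \<le> dist w z + dist p p'"
    using dist_triangle[of p z p'] dist_triangle[of p' z w] dist_triangle[of p' w p] dist_triangle[of p w z]
      dist_commute[of w z] dist_commute[of p' p] by linarith
  then show ?thesis using bigon[OF z(1) assms(2)] z(2) dist_triangle[of w w' z] by linarith
qed

lemma far_seq_trans:
  assumes "far_seq p M a b" "far_seq p M b c"
  shows "far_seq (p::'a) (M - \<delta>) a c"
proof -
  obtain T1 where 1: "\<forall>s\<ge>T1. \<forall>t\<ge>T1. far p M (a s) (b t)" using assms(1) by (auto simp: far_seq_def)
  obtain T2 where 2: "\<forall>s\<ge>T2. \<forall>t\<ge>T2. far p M (b s) (c t)" using assms(2) by (auto simp: far_seq_def)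
  have "far p (M - \<delta>) (a s) (c t)" if "s \<ge> max T1 T2" "t \<ge> max T1 T2" for s t
    by (rule far_trans[of _ _ _ "b (max T1 T2)"]) (use 1 2 that in auto)
  then show ?thesis unfolding far_seq_def by blast
qed

lemma seq_equiv_trans:
  assumes "seq_equiv a b" "seq_equiv b (c::nat \<Rightarrow> 'a)" shows "seq_equiv a c"
  unfolding seq_equiv_def
proof (intro allI)
  fix p M
  have "far_seq p (M + \<delta> - \<delta>) a c"
    by (rule far_seq_trans) (use assms in \<open>auto simp: seq_equiv_def\<close>)
  then show "far_seq p M a c" by simp
qed

lemma seq_equiv_bounded:
  assumes "seq_equiv a c" "\<And>n. dist (a n) (b n) \<le> K" shows "seq_equiv b (c::nat \<Rightarrow> 'a)"
proof (rule seq_equivI)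
  fix p M
  have "far_seq p (M + \<delta> + K) a c" using assms by (simp add: seq_equiv_def)
  then obtain T where T: "\<forall>s\<ge>T. \<forall>t\<ge>T. far p (M + \<delta> + K) (a s) (c t)" by (auto simp: far_seq_def)
  have K: "0 \<le> K" using assms(2)[of 0] zero_le_dist[of "a 0" "b 0"] by linarith
  have "far p (M + \<delta> - \<delta>) (b s) (c t)" if "s \<ge> T" "t \<ge> T" for s t
  proof (rule far_trans[of _ _ _ "a s"])
    have f: "far p (M + \<delta> + K) (a s) (c t)" using T that by blast
    show "far p (M + \<delta>) (a s) (c t)" by (rule far_mono[OF f]) (use K in simp)
    have "far p (M + \<delta>) (a s) (b s)" by (rule far_near[OF assms(2)]) (rule far_left[OF f])
    then show "far p (M + \<delta>) (b s) (a s)" by (simp add: far_sym)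
  qed
  then show "far_seq p M b c" unfolding far_seq_def by auto
qed

text \<open>Bisecting the parameter interval \<open>m\<close> times costs one \<open>\<delta>\<close> each, so the distance grows only
  logarithmically in the length of the path; no continuity is involved.\<close>

lemma geodesic_near_path:
  fixes \<phi> :: "real \<Rightarrow> 'a"
  assumes up: "\<And>s t. s \<in> {0..L} \<Longrightarrow> t \<in> {0..L} \<Longrightarrow> dist (\<phi> s) (\<phi> t) \<le> k * \<bar>s - t\<bar> + \<epsilon>"
    and k: "0 \<le> k"
  shows "0 \<le> s \<Longrightarrow> s \<le> t \<Longrightarrow> t \<le> L \<Longrightarrow> t - s \<le> 2 ^ m \<Longrightarrow> btw (\<phi> s) u (\<phi> t) \<Longrightarrow>
    \<exists>r\<in>{0..L}. dist u (\<phi> r) \<le> real m * \<delta> + k + \<epsilon>"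
proof (induction m arbitrary: s t u)
  case 0
  then have "dist (\<phi> s) (\<phi> t) \<le> k * (t - s) + \<epsilon>" using up[of s t] by auto
  also have "\<dots> \<le> k * 1 + \<epsilon>" using 0 k by (intro add_right_mono mult_left_mono) auto
  finally have "dist u (\<phi> s) \<le> k + \<epsilon>"
    using 0(5) zero_le_dist[of u "\<phi> t"] dist_commute[of u "\<phi> s"] unfolding btw_def by linarith
  then show ?case using 0 by (intro bexI[of _ s]) auto
next
  case (Suc m)
  let ?r = "(s + t) / 2"
  have half: "0 \<le> ?r" "s \<le> ?r" "?r \<le> t" "?r \<le> L" "?r - s \<le> 2 ^ m" "t - ?r \<le> 2 ^ m"
    using Suc.prems by (auto simp: field_simps)
  obtain v where v: "btw (\<phi> t) v (\<phi> ?r) \<or> btw (\<phi> ?r) v (\<phi> s)" "dist u v \<le> \<delta>"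
    using Suc.prems(5) by (rule slim)
  from v(1) have "\<exists>r\<in>{0..L}. dist v (\<phi> r) \<le> real m * \<delta> + k + \<epsilon>"
  proof
    assume "btw (\<phi> t) v (\<phi> ?r)"
    then show ?thesis using Suc.IH[of ?r t v] Suc.prems half by (simp add: btw_sym)
  next
    assume "btw (\<phi> ?r) v (\<phi> s)"
    then show ?thesis using Suc.IH[of s ?r v] Suc.prems half by (simp add: btw_sym)
  qed
  then obtain r where "r \<in> {0..L}" "dist v (\<phi> r) \<le> real m * \<delta> + k + \<epsilon>" by blast
  then show ?case using v(2) dist_triangle[of u "\<phi> r" v]
    by (intro bexI[of _ r]) (auto simp: algebra_simps)
qed

end

section \<open>Stability of quasigeodesics\<close>

lemma btw_trans:
  assumes "btw x u z" "btw x y u"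
  shows "btw x y z" "btw y u z"
  using assms dist_triangle[of x z y] dist_triangle[of y z u] unfolding btw_def by linarith+

lemma exponential_beats_linear:
  fixes a b :: real
  shows "\<exists>m0::nat. \<forall>m\<ge>m0. a + b * real m \<le> 2 ^ m"
proof -
  have "(\<lambda>m. real m * (1/2) ^ m) \<longlonglongrightarrow> 0"
    using powser_times_n_limit_0[of "1/2::real"] by simp
  moreover have "(\<lambda>m. (1/2::real) ^ m) \<longlonglongrightarrow> 0"
    by (rule LIMSEQ_power_zero) simp
  ultimately have "(\<lambda>m. a * (1/2) ^ m + b * (real m * (1/2) ^ m)) \<longlonglongrightarrow> a * 0 + b * 0"
    by (intro tendsto_add tendsto_mult tendsto_const)
  then have "\<forall>\<^sub>F m in sequentially. a * (1/2) ^ m + b * (real m * (1/2) ^ m) < 1"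
    by (rule order_tendstoD(2)) simp
  then obtain m0 where m0: "\<And>m. m \<ge> m0 \<Longrightarrow> a * (1/2) ^ m + b * (real m * (1/2) ^ m) < 1"
    unfolding eventually_sequentially by blast
  have "a + b * real m \<le> 2 ^ m" if "m \<ge> m0" for m
  proof -
    have "(a * (1/2) ^ m + b * (real m * (1/2) ^ m)) * 2 ^ m \<le> 1 * 2 ^ m"
      using m0[OF that] by (intro mult_right_mono) auto
    moreover have "(1/2::real) ^ m * 2 ^ m = 1" by (simp add: power_mult_distrib[symmetric])
    ultimately show ?thesis by (simp add: algebra_simps)
  qed
  then show ?thesis by blast
qed

text \<open>A bound on \<open>B\<close> that is logarithmic in \<open>B\<close> is absolute. If the
  least admissible exponent were \<open>Suc l\<close> with \<open>m0 \<le> l\<close>, inserting its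
  bound on \<open>B\<close> would make \<open>l\<close> admissible too. \<open>D\<close> depends on
  the constants alone, hence is uniform over all quasigeodesics.\<close>

lemma log_growth_bound:
  fixes \<alpha> \<beta> C \<delta> :: real
  assumes "0 \<le> \<alpha>" "0 \<le> \<delta>"
  shows "\<exists>D. \<forall>B. (\<forall>m::nat. \<alpha> * B + \<beta> \<le> 2 ^ m \<longrightarrow> B \<le> C + real m * \<delta>) \<longrightarrow> B \<le> D"
proof -
  obtain m0 :: nat
    where m0: "\<And>m. m \<ge> m0 \<Longrightarrow> (\<alpha> * (C + \<delta>) + \<beta>) + (\<alpha> * \<delta>) * real m \<le> 2 ^ m"
    using exponential_beats_linear by blast
  have "B \<le> C + real m0 * \<delta>" if B: "\<And>m::nat. \<alpha> * B + \<beta> \<le> 2 ^ m \<Longrightarrow> B \<le> C + real m * \<delta>" for B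
  proof -
    define m where "m = (LEAST m::nat. \<alpha> * B + \<beta> \<le> 2 ^ m)"
    have "\<exists>m::nat. \<alpha> * B + \<beta> \<le> 2 ^ m" using real_arch_pow[of 2 "\<alpha> * B + \<beta>"] by (auto intro: less_imp_le)
    then have m: "\<alpha> * B + \<beta> \<le> 2 ^ m" unfolding m_def by (rule LeastI_ex)
    show ?thesis
    proof (cases "m \<le> m0")
      case True
      then have "real m * \<delta> \<le> real m0 * \<delta>" using assms by (intro mult_right_mono) auto
      then show ?thesis using B[OF m] by linarith
    next
      case False
      then obtain l where l: "m = Suc l" "m0 \<le> l" by (cases m) auto
      have "\<alpha> * B \<le> \<alpha> * (C + real m * \<delta>)" by (rule mult_left_mono[OF B[OF m] assms(1)])
      then have "\<alpha> * B + \<beta> \<le> 2 ^ l" using m0[OF l(2)] l(1) by (simp add: algebra_simps)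
      then have "m \<le> l" unfolding m_def by (rule Least_le)
      then show ?thesis using l by simp
    qed
  qed
  then show ?thesis by blast
qed

context geodesic_hyperbolic
begin

text \<open>The chain \<open>x'\<close>, \<open>x\<close>, \<open>y\<close>, \<open>y'\<close> has
  two joints, which cost \<open>2 * \<delta>\<close>; \<open>K\<close> keeps the two short legs away
  from \<open>p\<close>.\<close>

lemma far_bounded:
  assumes "far p (M + 2 * \<delta> + K) x y" "dist x x' \<le> K" "dist y y' \<le> K"
  shows "far (p::'a) M x' y'"
proof -
  note d = delta_nonneg
  have K: "0 \<le> K" using assms(2) zero_le_dist[of x x'] by linarith
  have "far p (M + 2 * \<delta>) x x'" by (rule far_near[OF assms(2)]) (use far_left[OF assms(1)] in simp)
  then have 1: "far p (M + 2 * \<delta>) x' x" by (simp add: far_sym)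
  have 2: "far p (M + 2 * \<delta>) y y'" by (rule far_near[OF assms(3)]) (use far_right[OF assms(1)] in simp)
  have "far p (M + 2 * \<delta>) x y" by (rule far_mono[OF assms(1)]) (use K in simp)
  with 1 have "far p (M + 2 * \<delta> - \<delta>) x' y" by (rule far_trans)
  moreover have "far p (M + 2 * \<delta> - \<delta>) y y'" by (rule far_mono[OF 2]) (use d in simp)
  ultimately have "far p (M + 2 * \<delta> - \<delta> - \<delta>) x' y'" by (rule far_trans)
  then show ?thesis by simp
qed

text \<open>\<open>B\<close> is almost the best bound on the distance from the geodesic to the quasigeodesic, and \<open>u0\<close> almost
  realizes it. Going from \<open>u0\<close> a distance \<open>2 * B\<close> along the geodesic in both directions and from there
  over to the quasigeodesic cuts out a piece of it of length linear in \<open>B\<close>, which by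
  \<open>geodesic_near_path\<close> comes logarithmically close to \<open>u0\<close>.\<close>

lemma quasigeodesic_excursion_bound:
  fixes \<phi> :: "real \<Rightarrow> 'a"
  assumes up: "\<And>s t. s \<in> {0..L} \<Longrightarrow> t \<in> {0..L} \<Longrightarrow> dist (\<phi> s) (\<phi> t) \<le> k * \<bar>s - t\<bar> + \<epsilon>"
    and lo: "\<And>s t. s \<in> {0..L} \<Longrightarrow> t \<in> {0..L} \<Longrightarrow> \<bar>s - t\<bar> \<le> k * (dist (\<phi> s) (\<phi> t) + \<epsilon>)"
    and k: "0 \<le> k" "0 \<le> \<epsilon>" and L: "0 \<le> L"
    and near: "\<And>u. btw (\<phi> 0) u (\<phi> L) \<Longrightarrow> \<exists>r\<in>{0..L}. dist u (\<phi> r) \<le> B"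
    and u0: "btw (\<phi> 0) u0 (\<phi> L)" "\<And>r. r \<in> {0..L} \<Longrightarrow> B - 2 < dist u0 (\<phi> r)"
    and m: "6 * k * B + k * \<epsilon> \<le> 2 ^ m"
  shows "B \<le> 2 * \<delta> + 2 + k + \<epsilon> + real m * \<delta>"
proof -
  note d = delta_nonneg
  have md: "0 \<le> real m * \<delta>" using d by simp
  have B0: "0 \<le> B" using near[of "\<phi> 0"] zero_le_dist order_trans by (metis btw_ends(1))
  \<comment> \<open>If the end \<open>e\<close> comes before distance \<open>2 * B\<close>, the walk
    stops there. The end lies on the quasigeodesic, so the passage over to it is trivial.\<close>
  have side: "\<exists>y. \<exists>a\<in>{0..L}. btw e y u0 \<and> dist y (\<phi> a) \<le> B \<and> dist u0 y \<le> 2 * B \<and>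
      (\<phi> a = y \<or> dist u0 y = 2 * B)"
    if e: "e = \<phi> t0" "t0 \<in> {0..L}" "\<And>y. btw e y u0 \<Longrightarrow> btw (\<phi> 0) y (\<phi> L)" for e t0
  proof (cases "dist u0 e \<le> 2 * B")
    case True
    then show ?thesis using e B0 by (intro exI[of _ e] bexI[of _ t0]) auto
  next
    case False
    then obtain y where y: "btw u0 y e" "dist u0 y = 2 * B"
      using geodesic_point[of "2 * B" u0 e] B0 by auto
    then have "btw e y u0" by (simp add: btw_sym)
    then show ?thesis using near[OF e(3)] y by (intro exI[of _ y]) auto
  qed
  \<comment> \<open>The passages cannot come near \<open>u0\<close> unless \<open>B\<close> is
    small: one that starts at distance \<open>2 * B\<close> has length at most \<open>B\<close>, and
    a trivial one is a point of the quasigeodesic, more than \<open>B - 2\<close> away.\<close>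
  have excl: "B \<le> 2 * \<delta> + 2"
    if "dist y (\<phi> a) \<le> B" "\<phi> a = y \<or> dist u0 y = 2 * B" "a \<in> {0..L}" "btw y w (\<phi> a)" "dist u0 w \<le> 2 * \<delta>"
    for y a w
    using that(2)
  proof
    assume "\<phi> a = y"
    then have "w = \<phi> a" using that(4) by simp
    then show ?thesis using u0(2)[OF that(3)] that(5) by simp
  next
    assume "dist u0 y = 2 * B"
    moreover have "dist y w \<le> B" using that(1,4) zero_le_dist[of w "\<phi> a"] unfolding btw_def by linarith
    ultimately show ?thesis using that(5) dist_triangle[of u0 y w] dist_commute[of w y] by linarith
  qed
  have u0': "btw (\<phi> L) u0 (\<phi> 0)" using u0(1) by (simp add: btw_sym)
  have "\<exists>y. \<exists>a\<in>{0..L}. btw (\<phi> 0) y u0 \<and> dist y (\<phi> a) \<le> B \<and> dist u0 y \<le> 2 * B \<and>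
      (\<phi> a = y \<or> dist u0 y = 2 * B)"
    by (rule side[of _ 0]) (use L btw_trans(1)[OF u0(1)] in auto)
  then obtain y a where y: "a \<in> {0..L}" "btw (\<phi> 0) y u0" "dist y (\<phi> a) \<le> B" "dist u0 y \<le> 2 * B"
      "\<phi> a = y \<or> dist u0 y = 2 * B" by blast
  have "\<exists>z. \<exists>b\<in>{0..L}. btw (\<phi> L) z u0 \<and> dist z (\<phi> b) \<le> B \<and> dist u0 z \<le> 2 * B \<and>
      (\<phi> b = z \<or> dist u0 z = 2 * B)"
    by (rule side[of _ L]) (use L btw_trans(1)[OF u0'] in \<open>auto simp: btw_sym\<close>)
  then obtain z b where z: "b \<in> {0..L}" "btw (\<phi> L) z u0" "dist z (\<phi> b) \<le> B" "dist u0 z \<le> 2 * B"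
      "\<phi> b = z \<or> dist u0 z = 2 * B" by blast
  have "btw y u0 (\<phi> L)" by (rule btw_trans(2)[OF u0(1) y(2)])
  then have "btw (\<phi> L) u0 y" by (simp add: btw_sym)
  then have "btw z u0 y" using z(2) by (rule btw_trans(2))
  then have "btw y u0 z" by (simp add: btw_sym)
  \<comment> \<open>The quadrilateral \<open>y\<close>, \<open>z\<close>, \<open>\<phi> b\<close>,
    \<open>\<phi> a\<close> is cut along the diagonal from \<open>\<phi> b\<close> to
    \<open>y\<close>; its two triangles move \<open>u0\<close> by at most
    \<open>2 * \<delta>\<close>.\<close>
  then obtain v where v: "btw z v (\<phi> b) \<or> btw (\<phi> b) v y" "dist u0 v \<le> \<delta>" by (rule slim)
  from v(1) show ?thesis
  proof
    assume "btw z v (\<phi> b)"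
    then have "B \<le> 2 * \<delta> + 2" by (intro excl[of z b v]) (use z v d in auto)
    then show ?thesis using k md by linarith
  next
    assume "btw (\<phi> b) v y"
    then obtain w where w: "btw y w (\<phi> a) \<or> btw (\<phi> a) w (\<phi> b)" "dist v w \<le> \<delta>" by (rule slim)
    have uw: "dist u0 w \<le> 2 * \<delta>" using v(2) w(2) dist_triangle[of u0 w v] by linarith
    from w(1) show ?thesis
    proof
      assume "btw y w (\<phi> a)"
      then have "B \<le> 2 * \<delta> + 2" by (intro excl[of y a w]) (use y uw in auto)
      then show ?thesis using k md by linarith
    next
      assume w': "btw (\<phi> a) w (\<phi> b)"
      \<comment> \<open>Along \<open>y\<close>, \<open>u0\<close>, \<open>z\<close> the legs have
        lengths at most \<open>B\<close>, \<open>2 * B\<close>, \<open>2 * B\<close>,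
        \<open>B\<close>.\<close>
      have "dist (\<phi> a) (\<phi> b) \<le> 6 * B"
        using y z dist_triangle[of "\<phi> a" "\<phi> b" y] dist_triangle[of y "\<phi> b" u0]
          dist_triangle[of u0 "\<phi> b" z] dist_commute[of y "\<phi> a"] dist_commute[of u0 y] by linarith
      then have "k * (dist (\<phi> a) (\<phi> b) + \<epsilon>) \<le> k * (6 * B + \<epsilon>)" using k by (intro mult_left_mono) auto
      then have ab: "\<bar>a - b\<bar> \<le> 2 ^ m" using lo[OF y(1) z(1)] m by (simp add: algebra_simps)
      have "\<exists>r\<in>{0..L}. dist w (\<phi> r) \<le> real m * \<delta> + k + \<epsilon>"
      proof (cases "a \<le> b")
        case True
        then show ?thesis
          using geodesic_near_path[of L \<phi> k \<epsilon> a b m w, OF up k(1)] y(1) z(1) w' ab by auto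
      next
        case False
        then show ?thesis
          using geodesic_near_path[of L \<phi> k \<epsilon> b a m w, OF up k(1)] y(1) z(1) w' ab
          by (auto simp: btw_sym)
      qed
      then obtain r where r: "r \<in> {0..L}" "dist w (\<phi> r) \<le> real m * \<delta> + k + \<epsilon>" by blast
      then show ?thesis using u0(2)[OF r(1)] uw dist_triangle[of u0 "\<phi> r" w] by linarith
    qed
  qed
qed

lemma geodesic_near_quasigeodesic:
  assumes k: "0 \<le> k" "0 \<le> \<epsilon>"
  shows "\<exists>D. \<forall>L (\<phi>::real \<Rightarrow> 'a) u. 0 \<le> L \<longrightarrow>
     (\<forall>s\<in>{0..L}. \<forall>t\<in>{0..L}. dist (\<phi> s) (\<phi> t) \<le> k * \<bar>s - t\<bar> + \<epsilon>) \<longrightarrow>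
     (\<forall>s\<in>{0..L}. \<forall>t\<in>{0..L}. \<bar>s - t\<bar> \<le> k * (dist (\<phi> s) (\<phi> t) + \<epsilon>)) \<longrightarrow>
     btw (\<phi> 0) u (\<phi> L) \<longrightarrow> (\<exists>r\<in>{0..L}. dist u (\<phi> r) \<le> D)"
proof -
  have k6: "0 \<le> 6 * k" using k by simp
  obtain D where D: "\<And>B. (\<And>m::nat. 6 * k * B + k * \<epsilon> \<le> 2 ^ m \<Longrightarrow>
      B \<le> (2 * \<delta> + 2 + k + \<epsilon>) + real m * \<delta>) \<Longrightarrow> B \<le> D"
    using log_growth_bound[OF k6 delta_nonneg] by metis
  have "\<exists>r\<in>{0..L}. dist u (\<phi> r) \<le> D"
    if L: "0 \<le> L"
      and up: "\<And>s t. s \<in> {0..L} \<Longrightarrow> t \<in> {0..L} \<Longrightarrow> dist (\<phi> s) (\<phi> t) \<le> k * \<bar>s - t\<bar> + \<epsilon>"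
      and lo: "\<And>s t. s \<in> {0..L} \<Longrightarrow> t \<in> {0..L} \<Longrightarrow> \<bar>s - t\<bar> \<le> k * (dist (\<phi> s) (\<phi> t) + \<epsilon>)"
      and u: "btw (\<phi> 0) u (\<phi> L)" for L u and \<phi> :: "real \<Rightarrow> 'a"
  proof -
    \<comment> \<open>Since \<open>\<phi>\<close> may be discontinuous, neither a best bound nor a
      farthest point need be attained. A bound less than 1 above the infimum and a point at which
      \<open>B - 2\<close> fails take their place.\<close>
    define S where "S = {B. \<forall>u. btw (\<phi> 0) u (\<phi> L) \<longrightarrow> (\<exists>r\<in>{0..L}. dist u (\<phi> r) \<le> B)}"
    have "dist (\<phi> 0) (\<phi> L) \<in> S"
      unfolding S_def
    proof (intro CollectI allI impI)
      fix u assume "btw (\<phi> 0) u (\<phi> L)"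
      then have "dist u (\<phi> 0) \<le> dist (\<phi> 0) (\<phi> L)"
        using zero_le_dist[of u "\<phi> L"] dist_commute[of u "\<phi> 0"] unfolding btw_def by linarith
      then show "\<exists>r\<in>{0..L}. dist u (\<phi> r) \<le> dist (\<phi> 0) (\<phi> L)" using L by auto
    qed
    then have ne: "S \<noteq> {}" by blast
    have bd: "bdd_below S"
    proof (rule bdd_belowI)
      fix B assume "B \<in> S"
      then obtain r where "dist (\<phi> 0) (\<phi> r) \<le> B" unfolding S_def by (auto dest: spec[of _ "\<phi> 0"])
      then show "0 \<le> B" using zero_le_dist order_trans by blast
    qed
    obtain B where B: "B \<in> S" "B < Inf S + 1" using cInf_lessD[OF ne, of "Inf S + 1"] by auto
    have "B - 2 \<notin> S" using cInf_lower[OF _ bd, of "B - 2"] B(2) by auto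
    then obtain u0 where u0: "btw (\<phi> 0) u0 (\<phi> L)" "\<And>r. r \<in> {0..L} \<Longrightarrow> B - 2 < dist u0 (\<phi> r)"
      unfolding S_def by (auto simp: not_le)
    have "B \<le> D"
    proof (rule D)
      fix m :: nat assume m: "6 * k * B + k * \<epsilon> \<le> 2 ^ m"
      show "B \<le> (2 * \<delta> + 2 + k + \<epsilon>) + real m * \<delta>"
        by (rule quasigeodesic_excursion_bound[OF up lo k L _ u0 m]) (use B(1) in \<open>auto simp: S_def\<close>)
    qed
    moreover obtain r where "r \<in> {0..L}" "dist u (\<phi> r) \<le> B" using B(1) u by (auto simp: S_def)
    ultimately show ?thesis by force
  qed
  then show ?thesis by blast
qed

text \<open>A point \<open>u\<close> between the images is close to the image of some point
  \<open>c r\<close> of a geodesic from \<open>x\<close> to \<open>y\<close>. As \<open>c r\<close>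
  is far from \<open>q\<close>, the lower quasi-isometry bound puts its image far from
  \<open>\<pi> q\<close>.\<close>

lemma quasi_isometry_far:
  fixes \<pi> :: "'b::metric_space \<Rightarrow> 'a"
  assumes gb: "geodesic_metric TYPE('b)" and qi: "quasi_isometry \<pi>"
  shows "\<exists>N. \<forall>x y. far q N x y \<longrightarrow> far p M (\<pi> x) (\<pi> y)"
proof -
  obtain k \<epsilon> where k: "1 \<le> k" "0 \<le> \<epsilon>"
    and lo': "\<And>x y. dist x y / k - \<epsilon> \<le> dist (\<pi> x) (\<pi> y)"
    and up: "\<And>x y. dist (\<pi> x) (\<pi> y) \<le> k * dist x y + \<epsilon>"
    using qi unfolding quasi_isometry_def by blast
  have k0: "0 \<le> k" "0 < k" using k by auto
  have lo: "dist x y \<le> k * (dist (\<pi> x) (\<pi> y) + \<epsilon>)" for x y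
    using lo'[of x y] k0 by (simp add: field_simps)
  obtain D where D: "\<And>L (\<phi>::real \<Rightarrow> 'a) u. 0 \<le> L \<Longrightarrow>
     \<forall>s\<in>{0..L}. \<forall>t\<in>{0..L}. dist (\<phi> s) (\<phi> t) \<le> k * \<bar>s - t\<bar> + \<epsilon> \<Longrightarrow>
     \<forall>s\<in>{0..L}. \<forall>t\<in>{0..L}. \<bar>s - t\<bar> \<le> k * (dist (\<phi> s) (\<phi> t) + \<epsilon>) \<Longrightarrow>
     btw (\<phi> 0) u (\<phi> L) \<Longrightarrow> \<exists>r\<in>{0..L}. dist u (\<phi> r) \<le> D"
    using geodesic_near_quasigeodesic[OF k0(1) k(2)] by metis
  \<comment> \<open>Chosen so that \<open>N / k - \<epsilon> = M + dist p (\<pi> q) + D\<close>; the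
    last two terms pay for the change of base point and for the step to \<open>u\<close>.\<close>
  define N where "N = k * (M + dist p (\<pi> q) + D + \<epsilon>)"
  have "far p M (\<pi> x) (\<pi> y)" if f: "far q N x y" for x y
    unfolding far_def
  proof (intro allI impI)
    fix u assume u: "btw (\<pi> x) u (\<pi> y)"
    obtain c where c: "isometric_on {0..dist x y} c" "c 0 = x" "c (dist x y) = y"
      using gb unfolding geodesic_metric_def by blast
    have iso: "dist (c s) (c t) = \<bar>s - t\<bar>" if "s \<in> {0..dist x y}" "t \<in> {0..dist x y}" for s t
      using c(1) that by (simp add: isometric_on_def)
    have "\<exists>r\<in>{0..dist x y}. dist u ((\<pi> \<circ> c) r) \<le> D"
    proof (rule D)
      show "\<forall>s\<in>{0..dist x y}. \<forall>t\<in>{0..dist x y}. dist ((\<pi> \<circ> c) s) ((\<pi> \<circ> c) t) \<le> k * \<bar>s - t\<bar> + \<epsilon>"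
        using up iso by (metis comp_apply)
      show "\<forall>s\<in>{0..dist x y}. \<forall>t\<in>{0..dist x y}. \<bar>s - t\<bar> \<le> k * (dist ((\<pi> \<circ> c) s) ((\<pi> \<circ> c) t) + \<epsilon>)"
        using lo iso by (metis comp_apply)
    qed (use c u in auto)
    then obtain r where r: "r \<in> {0..dist x y}" "dist u (\<pi> (c r)) \<le> D" by auto
    have "btw x (c r) y" using iso[of 0 r] iso[of r "dist x y"] r(1) c by (simp add: btw_def)
    then have "N \<le> dist q (c r)" using f by (simp add: far_def)
    also have "\<dots> \<le> k * (dist (\<pi> q) (\<pi> (c r)) + \<epsilon>)" by (rule lo)
    finally have "M + dist p (\<pi> q) + D + \<epsilon> \<le> dist (\<pi> q) (\<pi> (c r)) + \<epsilon>"
      unfolding N_def using k0 by simp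
    then show "M \<le> dist p u"
      using r(2) dist_triangle[of "\<pi> q" "\<pi> (c r)" p] dist_triangle[of p "\<pi> (c r)" u]
        dist_commute[of p "\<pi> q"] by linarith
  qed
  then show ?thesis by blast
qed

end

section \<open>Rays and boundary points\<close>

lemma dense_sequence_nonneg:
  obtains d :: "nat \<Rightarrow> real" where "\<And>n. 0 \<le> d n" "\<And>t e. 0 \<le> t \<Longrightarrow> 0 < e \<Longrightarrow> \<exists>n. \<bar>d n - t\<bar> < e"
proof
  let ?d = "\<lambda>n. \<bar>real_of_rat (nat_to_rat_surj n)\<bar>"
  show "0 \<le> ?d n" for n by simp
  fix t e :: real assume te: "0 \<le> t" "0 < e"
  then obtain x where x: "t < real_of_rat x" "real_of_rat x < t + e" using of_rat_dense[of t "t + e"] by auto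
  obtain n where n: "x = nat_to_rat_surj n" using surj_nat_to_rat_surj by (metis surjD)
  have "\<bar>?d n - t\<bar> < e" using x te unfolding n by linarith
  then show "\<exists>n. \<bar>?d n - t\<bar> < e" ..
qed

text \<open>A diagonal argument gives convergence at a dense set of times, the Lipschitz bound
  extends it to all times. One subsequence serves all compact \<open>K\<close>, as convergence in
  the compactification demands.\<close>

lemma Arzela_Ascoli_Lipschitz:
  fixes f :: "nat \<Rightarrow> real \<Rightarrow> 'a::metric_space"
  assumes proper: "proper_metric TYPE('a)"
    and lip: "\<And>n s t. 0 \<le> s \<Longrightarrow> 0 \<le> t \<Longrightarrow> dist (f n s) (f n t) \<le> \<bar>s - t\<bar>"
    and base: "\<And>n. f n 0 = p"
  shows "\<exists>r g. strict_mono (r::nat \<Rightarrow> nat) \<and>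
    (\<forall>K. compact K \<longrightarrow> K \<subseteq> {0..} \<longrightarrow> uniform_limit K (\<lambda>n. f (r n)) g sequentially)"
proof -
  obtain d :: "nat \<Rightarrow> real" where d: "\<And>n. 0 \<le> d n" "\<And>t e. 0 \<le> t \<Longrightarrow> 0 < e \<Longrightarrow> \<exists>n. \<bar>d n - t\<bar> < e"
    using dense_sequence_nonneg by blast
  have cmp: "compact (cball p t)" for t using proper by (simp add: proper_metric_def)
  have inball: "f n t \<in> cball p t" if "0 \<le> t" for n t
    using lip[of 0 t n] that by (simp add: base)
  define P where "P n s \<longleftrightarrow> convergent (\<lambda>i. f (s i) (d n))" for n and s :: "nat \<Rightarrow> nat"
  interpret subseqs P
  proof
    fix n and s :: "nat \<Rightarrow> nat"
    have "seq_compact (cball p (d n))" by (rule compact_imp_seq_compact[OF cmp])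
    moreover have "\<forall>i. f (s i) (d n) \<in> cball p (d n)" using inball d(1) by blast
    ultimately obtain l r where "strict_mono (r::nat \<Rightarrow> nat)" "((\<lambda>i. f (s i) (d n)) \<circ> r) \<longlonglongrightarrow> l"
      unfolding seq_compact_def by metis
    then show "\<exists>r'. strict_mono r' \<and> P n (s \<circ> r')" by (auto simp: P_def convergent_def comp_def)
  qed
  let ?r = diagseq
  have conv: "convergent (\<lambda>i. f (?r i) (d n))" for n
  proof -
    have "P n (s \<circ> r)" if "strict_mono r" "P n s" for n and s r :: "nat \<Rightarrow> nat"
      using that convergent_subseq_convergent[of "\<lambda>i. f (s i) (d n)" r] by (simp add: P_def comp_def)
    \<comment> \<open>Only from index \<open>Suc n\<close> on is the diagonal sequence a subsequence
      of the one chosen for time \<open>d n\<close>.\<close>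
    then have "P n (diagseq \<circ> ((+) (Suc n)))" by (intro diagseq_holds) auto
    then have "convergent (\<lambda>i. f (?r (i + Suc n)) (d n))" by (simp add: P_def comp_def add.commute)
    then show ?thesis using convergent_ignore_initial_segment[of "\<lambda>i. f (?r i) (d n)" "Suc n"] by simp
  qed
  have "\<exists>l. (\<lambda>i. f (?r i) t) \<longlonglongrightarrow> l" if t: "0 \<le> t" for t
  proof -
    have "Cauchy (\<lambda>i. f (?r i) t)"
    proof (rule metric_CauchyI)
      fix e :: real assume "0 < e"
      then obtain n where n: "\<bar>d n - t\<bar> < e / 3" using d(2)[OF t, of "e / 3"] by auto
      have "Cauchy (\<lambda>i. f (?r i) (d n))" by (rule convergent_Cauchy[OF conv])
      then obtain M where M: "\<And>i j. i \<ge> M \<Longrightarrow> j \<ge> M \<Longrightarrow> dist (f (?r i) (d n)) (f (?r j) (d n)) < e / 3"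
        using metric_CauchyD[of _ "e / 3"] \<open>0 < e\<close> by fastforce
      have "dist (f (?r i) t) (f (?r j) t) < e" if "i \<ge> M" "j \<ge> M" for i j
      proof -
        have "dist (f (?r i) t) (f (?r i) (d n)) < e / 3" "dist (f (?r j) (d n)) (f (?r j) t) < e / 3"
          using lip[OF t d(1), of "?r i" n] lip[OF d(1) t, of "?r j" n] n by linarith+
        then show ?thesis
          using M[OF that] dist_triangle[of "f (?r i) t" "f (?r j) t" "f (?r i) (d n)"]
            dist_triangle[of "f (?r i) (d n)" "f (?r j) t" "f (?r j) (d n)"] by linarith
      qed
      then show "\<exists>M. \<forall>m\<ge>M. \<forall>n\<ge>M. dist (f (?r m) t) (f (?r n) t) < e" by blast
    qed
    moreover have "complete (cball p t)" by (rule compact_imp_complete[OF cmp])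
    ultimately show ?thesis using inball[OF t] by (auto elim!: completeE)
  qed
  then obtain g where g: "\<And>t. 0 \<le> t \<Longrightarrow> (\<lambda>i. f (?r i) t) \<longlonglongrightarrow> g t" by metis
  have glip: "dist (g s) (g t) \<le> \<bar>s - t\<bar>" if "0 \<le> s" "0 \<le> t" for s t
    by (rule LIMSEQ_le_const2[OF tendsto_dist[OF g g]]) (use lip that in auto)
  have "uniform_limit K (\<lambda>n. f (?r n)) g sequentially" if K: "compact K" "K \<subseteq> {0..}" for K
    unfolding uniform_limit_iff
  proof (intro allI impI)
    fix e :: real assume e: "0 < e"
    then have "0 < e / 3" by simp
    \<comment> \<open>A finite net of times reduces uniform convergence on \<open>K\<close> to
      pointwise convergence.\<close>
    then obtain F where F: "finite F" "F \<subseteq> K" "K \<subseteq> (\<Union>x\<in>F. ball x (e / 3))"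
      using seq_compact_imp_totally_bounded[OF compact_imp_seq_compact[OF K(1)], rule_format, OF \<open>0 < e / 3\<close>]
      by (elim exE conjE) (rule that)
    have "\<forall>\<^sub>F n in sequentially. \<forall>x\<in>F. dist (f (?r n) x) (g x) < e / 3"
      using F K(2) e by (intro eventually_ball_finite ballI tendstoD[OF g]) auto
    then show "\<forall>\<^sub>F n in sequentially. \<forall>t\<in>K. dist (f (?r n) t) (g t) < e"
    proof eventually_elim
      case (elim n)
      show ?case
      proof
        fix t assume t: "t \<in> K"
        then obtain x where x: "x \<in> F" "\<bar>x - t\<bar> < e / 3" using F(3) by (auto simp: dist_real_def)
        have xt: "0 \<le> x" "0 \<le> t" using x(1) t F(2) K(2) by auto
        have "dist (f (?r n) x) (g x) < e / 3" using elim x(1) by blast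
        then show "dist (f (?r n) t) (g t) < e"
          using lip[OF xt(2,1), of "?r n"] glip[OF xt] x(2)
            dist_triangle[of "f (?r n) t" "g t" "f (?r n) x"] dist_triangle[of "f (?r n) x" "g t" "g x"]
          by linarith
      qed
    qed
  qed
  then show ?thesis using subseq_diagseq by blast
qed

section \<open>Asymptotic classes and generalized rays\<close>

lemma equiv_asymptotic: "equiv {c. geodesic_ray c} (asymptotic_rel :: ((real \<Rightarrow> 'a::metric_space) \<times> _) set)"
proof (rule equivI)
  show "asymptotic_rel \<subseteq> {c::real \<Rightarrow> 'a. geodesic_ray c} \<times> {c. geodesic_ray c}"
    by (auto simp: asymptotic_rel_def)
  show "refl_on {c::real \<Rightarrow> 'a. geodesic_ray c} asymptotic_rel"
    by (auto simp: refl_on_def asymptotic_rel_def)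
  show "sym (asymptotic_rel :: ((real \<Rightarrow> 'a) \<times> _) set)"
    by (auto simp: sym_def asymptotic_rel_def dist_commute)
  show "trans (asymptotic_rel :: ((real \<Rightarrow> 'a) \<times> _) set)"
  proof (rule transI)
    fix a b c :: "real \<Rightarrow> 'a" assume "(a, b) \<in> asymptotic_rel" "(b, c) \<in> asymptotic_rel"
    then obtain K K' where K: "\<forall>t\<ge>0. dist (a t) (b t) \<le> K" "\<forall>t\<ge>0. dist (b t) (c t) \<le> K'"
      and "geodesic_ray a" "geodesic_ray c"
      by (auto simp: asymptotic_rel_def)
    moreover have "\<forall>t\<ge>0. dist (a t) (c t) \<le> K + K'"
      using K dist_triangle add_mono order_trans by (metis (no_types, opaque_lifting))
    ultimately show "(a, c) \<in> asymptotic_rel" by (auto simp: asymptotic_rel_def)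
  qed
qed

lemma boundary_ray: "\<xi> \<in> gromov_boundary \<Longrightarrow> c \<in> \<xi> \<Longrightarrow> geodesic_ray c"
  by (auto simp: gromov_boundary_def asymptotic_rel_def elim!: quotientE)

lemma boundary_asymptotic:
  "\<xi> \<in> gromov_boundary \<Longrightarrow> c \<in> \<xi> \<Longrightarrow> c' \<in> \<xi> \<Longrightarrow> (c, c') \<in> asymptotic_rel"
  unfolding gromov_boundary_def by (rule quotient_eq_iff[THEN iffD1, OF equiv_asymptotic _ _ _ _ refl])

lemma boundary_eqI:
  assumes "\<xi> \<in> gromov_boundary" "\<xi>' \<in> gromov_boundary" "c \<in> \<xi>" "c' \<in> \<xi>'" "(c, c') \<in> asymptotic_rel"
  shows "\<xi> = \<xi>'"
  using assms quotient_eqI[OF equiv_asymptotic, of \<xi> \<xi>' c c'] by (auto simp: gromov_boundary_def)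

lemma boundary_class:
  "geodesic_ray c \<Longrightarrow> asymptotic_rel `` {c} \<in> gromov_boundary"
  "geodesic_ray c \<Longrightarrow> c \<in> asymptotic_rel `` {c}"
  using equiv_class_self[OF equiv_asymptotic] by (auto simp: gromov_boundary_def intro: quotientI)

lemma boundary_nonempty: "\<xi> \<in> gromov_boundary \<Longrightarrow> \<exists>c. c \<in> \<xi>"
  unfolding gromov_boundary_def using equiv_asymptotic in_quotient_imp_non_empty by blast

lemma ray_dist: "geodesic_ray c \<Longrightarrow> 0 \<le> s \<Longrightarrow> 0 \<le> t \<Longrightarrow> dist (c s) (c t) = \<bar>s - t\<bar>"
  by (simp add: geodesic_ray_def isometric_on_def)

lemma ray_btw: "geodesic_ray c \<Longrightarrow> 0 \<le> s \<Longrightarrow> s \<le> t \<Longrightarrow> btw (c 0) (c s) (c t)"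
  by (simp add: btw_def ray_dist)

lemma generalized_ray_Inr:
  "generalized_ray p c (Inr \<xi>) \<longleftrightarrow> \<xi> \<in> gromov_boundary \<and> c \<in> \<xi> \<and> geodesic_ray c \<and> c 0 = p"
  using boundary_ray by (auto simp: generalized_ray_def)

text \<open>The length \<open>R\<close> in the definition is forced to be \<open>dist p x\<close>.
  The minima describe the moving and the resting phase by one formula that survives passage to
  limits of paths and endpoints.\<close>

lemma generalized_ray_Inl:
  "generalized_ray p c (Inl x) \<longleftrightarrow> c 0 = p \<and> (\<forall>t\<ge>dist p x. c t = x) \<and>
     (\<forall>s\<ge>0. \<forall>t\<ge>0. dist (c s) (c t) = \<bar>min s (dist p x) - min t (dist p x)\<bar>)"
proof
  assume "generalized_ray p c (Inl x)"
  then obtain R where R: "R \<ge> 0" "isometric_on {0..R} c" "\<forall>t\<ge>R. c t = x" and c0: "c 0 = p"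
    by (auto simp: generalized_ray_def)
  have iso: "dist (c s) (c t) = \<bar>s - t\<bar>" if "0 \<le> s" "s \<le> R" "0 \<le> t" "t \<le> R" for s t
    using R(2) that by (simp add: isometric_on_def)
  have px: "dist p x = R" using iso[of 0 R] R c0 by auto
  have min: "c s = c (min s R)" for s using R(3) by (simp add: min_def)
  have "dist (c s) (c t) = \<bar>min s R - min t R\<bar>" if "0 \<le> s" "0 \<le> t" for s t
    unfolding min[of s] min[of t] by (rule iso) (use that R in auto)
  then show "c 0 = p \<and> (\<forall>t\<ge>dist p x. c t = x) \<and>
     (\<forall>s\<ge>0. \<forall>t\<ge>0. dist (c s) (c t) = \<bar>min s (dist p x) - min t (dist p x)\<bar>)"
    using c0 R px by simp
next
  assume "c 0 = p \<and> (\<forall>t\<ge>dist p x. c t = x) \<and>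
     (\<forall>s\<ge>0. \<forall>t\<ge>0. dist (c s) (c t) = \<bar>min s (dist p x) - min t (dist p x)\<bar>)"
  then show "generalized_ray p c (Inl x)"
    by (auto simp: generalized_ray_def isometric_on_def intro!: exI[of _ "dist p x"])
qed

lemma generalized_ray_start: "generalized_ray p c u \<Longrightarrow> c 0 = p"
  by (simp add: generalized_ray_def)

lemma generalized_ray_Lipschitz:
  assumes "generalized_ray p c u" "0 \<le> s" "0 \<le> t"
  shows "dist (c s) (c t) \<le> \<bar>s - t\<bar>"
proof (cases u)
  case (Inl x) then show ?thesis using assms by (auto simp: generalized_ray_Inl)
next
  case (Inr \<xi>) then show ?thesis using assms by (auto simp: generalized_ray_Inr ray_dist)
qed

lemma generalized_ray_btw:
  assumes "generalized_ray p c u" "0 \<le> s" "s \<le> t"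
  shows "btw p (c s) (c t)"
proof (cases u)
  case (Inl x)
  then have "c 0 = p" and d: "\<forall>s\<ge>0. \<forall>t\<ge>0. dist (c s) (c t) = \<bar>min s (dist p x) - min t (dist p x)\<bar>"
    using assms by (auto simp: generalized_ray_Inl)
  then have "btw (c 0) (c s) (c t)" using assms(2,3) unfolding btw_def by (auto simp: min_def)
  then show ?thesis using \<open>c 0 = p\<close> by simp
next
  case (Inr \<xi>)
  then show ?thesis using assms ray_btw[of c s t] by (auto simp: generalized_ray_Inr)
qed

text \<open>Encoding points of both kinds by sequences lets \<open>\<pi>\<close> act on boundary points by composition, although
  the image of a ray is not a ray.\<close>

definition represents :: "(nat \<Rightarrow> 'a::metric_space) \<Rightarrow> 'a + (real \<Rightarrow> 'a) set \<Rightarrow> bool" where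
  "represents a u \<longleftrightarrow> (case u of Inl x \<Rightarrow> \<exists>T. \<forall>s\<ge>T. a s = x
     | Inr \<xi> \<Rightarrow> \<xi> \<in> gromov_boundary \<and> (\<exists>c\<in>\<xi>. seq_equiv a (\<lambda>n. c (real n))))"

lemma represents_Inl: "represents a (Inl x) \<longleftrightarrow> (\<exists>T. \<forall>s\<ge>T. a s = x)"
  and represents_Inr: "represents a (Inr \<xi>) \<longleftrightarrow>
    \<xi> \<in> gromov_boundary \<and> (\<exists>c\<in>\<xi>. seq_equiv a (\<lambda>n. c (real n)))"
  by (simp_all add: represents_def)

context geodesic_hyperbolic
begin

lemma generalized_ray_Inl_exists: "\<exists>c. generalized_ray (p::'a) c (Inl x)"
proof -
  obtain c where c: "isometric_on {0..dist p x} c" "c 0 = p" "c (dist p x) = x" by (rule geodesic)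
  have "generalized_ray p (\<lambda>t. c (min t (dist p x))) (Inl x)"
    using c by (auto simp: generalized_ray_def isometric_on_def intro!: exI[of _ "dist p x"])
  then show ?thesis by blast
qed

lemma asymptotic_seq_equiv:
  assumes "(c, c'::real \<Rightarrow> 'a) \<in> asymptotic_rel"
  shows "seq_equiv (\<lambda>n. c (real n)) (\<lambda>n. c' (real n))"
proof (rule seq_equivI)
  fix M
  obtain K where ray: "geodesic_ray c" "geodesic_ray c'" and K: "\<And>t. t \<ge> 0 \<Longrightarrow> dist (c t) (c' t) \<le> K"
    using assms by (auto simp: asymptotic_rel_def)
  note d = delta_nonneg
  \<comment> \<open>The chain \<open>c s\<close>, \<open>c t\<close>, \<open>c' t\<close>,
    \<open>c' s'\<close> has two joints, whence \<open>2 * \<delta>\<close>. \<open>K\<close> pays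
    for its middle leg and, on the last leg, for the change of base point.\<close>
  define t where "t = \<bar>M\<bar> + K + 2 * \<delta>"
  have "0 \<le> K" using K[of 0] zero_le_dist order_trans by blast
  then have t: "0 \<le> t" "M + 2 * \<delta> \<le> t - K" using d by (auto simp: t_def)
  have "far (c 0) M (c s) (c' s')" if s: "s \<ge> t" "s' \<ge> t" for s s'
  proof -
    have "far (c 0) (dist (c 0) (c t)) (c t) (c s)" by (rule far_btw[OF ray_btw]) (use ray t s in auto)
    then have f1: "far (c 0) (M + 2 * \<delta>) (c s) (c t)"
      using t \<open>0 \<le> K\<close> by (auto simp: ray_dist ray far_sym intro: far_mono)
    have f2: "far (c 0) (M + 2 * \<delta>) (c t) (c' t)"
      by (rule far_near[OF K]) (use t in \<open>auto simp: ray_dist ray\<close>)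
    have "far (c' 0) (dist (c' 0) (c' t)) (c' t) (c' s')" by (rule far_btw[OF ray_btw]) (use ray t s in auto)
    then have "far (c 0) (t - dist (c' 0) (c 0)) (c' t) (c' s')"
      using far_base t by (fastforce simp: ray_dist ray)
    then have f3: "far (c 0) (M + 2 * \<delta> - \<delta>) (c' t) (c' s')"
      by (rule far_mono) (use K[of 0] t d dist_commute[of "c 0" "c' 0"] in linarith)
    have "far (c 0) (M + 2 * \<delta> - \<delta> - \<delta>) (c s) (c' s')"
      by (rule far_trans[OF far_trans[OF f1 f2] f3])
    then show ?thesis by simp
  qed
  then have "\<forall>s\<ge>nat \<lceil>t\<rceil>. \<forall>s'\<ge>nat \<lceil>t\<rceil>. far (c 0) M (c (real s)) (c' (real s'))"
    by (simp add: nat_ceiling_le_eq)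
  then show "far_seq (c 0) M (\<lambda>n. c (real n)) (\<lambda>n. c' (real n))"
    unfolding far_seq_def by blast
qed

text \<open>At equal times both rays are equally far from their starting points, so the last term of
  \<open>thin\<close> vanishes and the bound is independent of time.\<close>

lemma seq_equiv_asymptotic:
  fixes c c' :: "real \<Rightarrow> 'a"
  assumes ray: "geodesic_ray c" "geodesic_ray c'" and eq: "seq_equiv (\<lambda>n. c (real n)) (\<lambda>n. c' (real n))"
  shows "(c, c') \<in> asymptotic_rel"
proof -
  have "dist (c t) (c' t) \<le> 6 * \<delta> + 3 * dist (c' 0) (c 0)" if t: "0 \<le> t" for t
  proof -
    obtain T where T: "\<And>m n. m \<ge> T \<Longrightarrow> n \<ge> T \<Longrightarrow> far (c 0) (t + \<delta> + 1) (c (real m)) (c' (real n))"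
      using eq unfolding seq_equiv_def far_seq_def by meson
    define n where "n = max T (nat \<lceil>t\<rceil>)"
    have n: "n \<ge> T" "t \<le> real n" by (auto simp: n_def) (meson max.cobounded2 nat_ceiling_le_eq)
    have "dist (c t) (c' t) \<le> 6 * \<delta> + 3 * dist (c' 0) (c 0) + \<bar>dist (c 0) (c t) - dist (c' 0) (c' t)\<bar>"
      by (rule thin[OF ray_btw[OF ray(1)] ray_btw[OF ray(2)] T[OF n(1) n(1)]]) (use ray n t in \<open>auto simp: ray_dist\<close>)
    then show ?thesis using ray t by (simp add: ray_dist)
  qed
  then show ?thesis using ray by (auto simp: asymptotic_rel_def)
qed

lemma represents_generalized_ray:
  assumes "generalized_ray (p::'a) c u" shows "represents (\<lambda>n. c (real n)) u"
proof (cases u)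
  case (Inl x)
  then have "\<forall>t\<ge>dist p x. c t = x" using assms by (simp add: generalized_ray_Inl)
  then have "\<forall>s\<ge>nat \<lceil>dist p x\<rceil>. c (real s) = x" by (simp add: nat_ceiling_le_eq)
  then show ?thesis unfolding Inl represents_Inl by blast
next
  case (Inr \<xi>)
  then have c: "\<xi> \<in> gromov_boundary" "c \<in> \<xi>" using assms by (auto simp: generalized_ray_Inr)
  then have "seq_equiv (\<lambda>n. c (real n)) (\<lambda>n. c (real n))"
    by (intro asymptotic_seq_equiv boundary_asymptotic)
  then show ?thesis using c unfolding Inr represents_Inr by blast
qed

lemma represents_seq_equiv:
  assumes "represents a (Inr \<xi>)" "represents b (Inr (\<xi>::(real \<Rightarrow> 'a) set))"
  shows "seq_equiv a b"
proof -
  obtain c c' where "\<xi> \<in> gromov_boundary" "c \<in> \<xi>" "c' \<in> \<xi>"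
    and c: "seq_equiv a (\<lambda>n. c (real n))" "seq_equiv b (\<lambda>n. c' (real n))"
    using assms by (auto simp: represents_Inr)
  then have "seq_equiv (\<lambda>n. c (real n)) (\<lambda>n. c' (real n))"
    by (intro asymptotic_seq_equiv boundary_asymptotic)
  then show ?thesis using c seq_equiv_trans seq_equiv_sym by blast
qed

lemma represents_cong:
  "represents a (Inr (\<xi>::(real \<Rightarrow> 'a) set)) \<Longrightarrow> seq_equiv b a \<Longrightarrow> represents b (Inr \<xi>)"
  unfolding represents_Inr using seq_equiv_trans by blast

lemma represents_unique:
  assumes "represents a (Inr \<xi>)" "represents a (Inr (\<xi>'::(real \<Rightarrow> 'a) set))"
  shows "\<xi> = \<xi>'"
proof -
  obtain c c' where b: "\<xi> \<in> gromov_boundary" "c \<in> \<xi>" "\<xi>' \<in> gromov_boundary" "c' \<in> \<xi>'"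
    and "seq_equiv a (\<lambda>n. c (real n))" "seq_equiv a (\<lambda>n. c' (real n))"
    using assms by (auto simp: represents_Inr)
  then have "seq_equiv (\<lambda>n. c (real n)) (\<lambda>n. c' (real n))"
    using seq_equiv_trans seq_equiv_sym by blast
  then have "(c, c') \<in> asymptotic_rel" using b boundary_ray by (intro seq_equiv_asymptotic) auto
  then show ?thesis using b boundary_eqI by blast
qed

text \<open>Two sequences for a finite point agree from some index on; two for a boundary point are
  equivalent, and \<open>far_seq_trans\<close> replaces one by the other.\<close>

lemma represents_far_seq:
  assumes "represents a u" "represents a' u" "far_seq p M a b"
  shows "far_seq (p::'a) (M - \<delta>) a' b"
proof (cases u)
  case (Inl x)
  then obtain T T' where "\<forall>s\<ge>T. a s = x" "\<forall>s\<ge>T'. a' s = x" using assms by (auto simp: represents_Inl)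
  then have "far_seq p M a' b" using far_seq_cong[OF assms(3)] by blast
  then show ?thesis by (rule far_seq_mono) (use delta_nonneg in simp)
next
  case (Inr \<xi>)
  then have "seq_equiv a' a" using represents_seq_equiv assms by blast
  then show ?thesis using assms(3) far_seq_trans unfolding seq_equiv_def by blast
qed

end

section \<open>Limit rays in proper spaces\<close>

locale proper_hyperbolic = geodesic_hyperbolic \<delta> sp
  for \<delta> and sp :: "'a::metric_space itself" +
  assumes proper: "proper_metric sp"
begin

lemma proper': "proper_metric TYPE('a)"
  using proper by (simp add: proper_metric_def)

text \<open>The ray is a limit of segments from \<open>p\<close> to members of \<open>a\<close>
  along a subsequence. By \<open>thin\<close>, all late segments are within
  \<open>6 * \<delta>\<close> of each other at a given time, hence of the limit; this brings in the
  whole sequence.\<close>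

lemma Gromov_sequence_ray:
  assumes a: "seq_equiv a (a::nat \<Rightarrow> 'a)"
  obtains c where "geodesic_ray c" "c 0 = p" "seq_equiv a (\<lambda>n. c (real n))"
proof -
  note d = delta_nonneg
  obtain f where f: "\<And>n. generalized_ray p (f n) (Inl (a n))"
    using choice[of "\<lambda>n c. generalized_ray p c (Inl (a n))"] generalized_ray_Inl_exists by blast
  have f0: "f n 0 = p" for n by (rule generalized_ray_start[OF f])
  have lip: "dist (f n s) (f n t) \<le> \<bar>s - t\<bar>" if "0 \<le> s" "0 \<le> t" for n s t
    by (rule generalized_ray_Lipschitz[OF f that])
  obtain r g where r: "strict_mono (r::nat \<Rightarrow> nat)"
    and ul: "\<And>K. compact K \<Longrightarrow> K \<subseteq> {0..} \<Longrightarrow> uniform_limit K (\<lambda>n. f (r n)) g sequentially"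
    using Arzela_Ascoli_Lipschitz[where f = f, OF proper' lip f0] by metis
  have lim: "(\<lambda>n. f (r n) t) \<longlonglongrightarrow> g t" if "0 \<le> t" for t
    using tendsto_uniform_limitI[OF ul[of "{t}"]] that by auto
  have T: "\<exists>T. \<forall>m\<ge>T. \<forall>n\<ge>T. far p M (a m) (a n)" for M
    using a by (auto simp: seq_equiv_def far_seq_def)
  have iso: "dist (f n s) (f n t) = \<bar>s - t\<bar>" if "0 \<le> s" "0 \<le> t" "s \<le> dist p (a n)" "t \<le> dist p (a n)" for n s t
    using f[of n] that by (auto simp: generalized_ray_Inl)
  have "geodesic_ray g"
    unfolding geodesic_ray_def isometric_on_def
  proof (intro ballI)
    fix s t :: real assume "s \<in> {0..}" "t \<in> {0..}"
    then have st: "0 \<le> s" "0 \<le> t" by auto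
    obtain N where N: "\<forall>m\<ge>N. \<forall>n\<ge>N. far p (max s t) (a m) (a n)" using T by blast
    have "dist (f (r n) s) (f (r n) t) = \<bar>s - t\<bar>" if "n \<ge> N" for n
    proof (rule iso)
      have "r n \<ge> N" using seq_suble[OF r, of n] that by simp
      then have "max s t \<le> dist p (a (r n))" using N far_left by blast
      then show "s \<le> dist p (a (r n))" "t \<le> dist p (a (r n))" by auto
    qed (use st in auto)
    then have "\<forall>\<^sub>F n in sequentially. dist (f (r n) s) (f (r n) t) = \<bar>s - t\<bar>"
      by (auto simp: eventually_sequentially)
    then have "(\<lambda>n. dist (f (r n) s) (f (r n) t)) \<longlonglongrightarrow> \<bar>s - t\<bar>" by (rule tendsto_eventually)
    moreover have "(\<lambda>n. dist (f (r n) s) (f (r n) t)) \<longlonglongrightarrow> dist (g s) (g t)"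
      by (intro tendsto_dist lim st)
    ultimately show "dist (g s) (g t) = \<bar>s - t\<bar>" using LIMSEQ_unique by blast
  qed
  moreover have g0: "g 0 = p" using lim[of 0] by (simp add: f0 LIMSEQ_const_iff)
  moreover have "seq_equiv a (\<lambda>n. g (real n))"
  proof (rule seq_equivI)
    fix M
    \<comment> \<open>Of the \<open>8 * \<delta>\<close>, six cover the leg from
      \<open>f m t\<close> to \<open>g t\<close> and two the joints of the chain \<open>a m\<close>,
      \<open>f m t\<close>, \<open>g t\<close>, \<open>g s\<close>.\<close>
    define t where "t = \<bar>M\<bar> + 8 * \<delta>"
    have t: "0 \<le> t" "M + 2 * \<delta> \<le> t - 6 * \<delta>" using d by (auto simp: t_def)
    obtain N where N: "\<And>m n. m \<ge> N \<Longrightarrow> n \<ge> N \<Longrightarrow> far p (t + \<delta> + 1) (a m) (a n)" using T by blast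
    have aN: "t \<le> dist p (a m)" if "m \<ge> N" for m using far_left[OF N[OF that that]] d by linarith
    have ft: "dist p (f m t) = t" if "m \<ge> N" for m
      using iso[of 0 t m] t aN[OF that] f0 by simp
    have fb: "btw p (f m t) (a m)" if "m \<ge> N" for m
      using generalized_ray_btw[OF f t(1), of "dist p (a m)" m] f[of m] aN[OF that]
      by (simp add: generalized_ray_Inl)
    have fa: "dist (f m t) (f n t) \<le> 6 * \<delta>" if "m \<ge> N" "n \<ge> N" for m n
      using thin[OF fb[OF that(1)] fb[OF that(2)] N[OF that]] ft that by simp
    have fg: "dist (f m t) (g t) \<le> 6 * \<delta>" if "m \<ge> N" for m
    proof (rule LIMSEQ_le_const2[OF tendsto_dist[OF tendsto_const lim[OF t(1)]]])
      show "\<exists>N. \<forall>n\<ge>N. dist (f m t) (f (r n) t) \<le> 6 * \<delta>"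
        using fa[OF that] seq_suble[OF r] le_trans by blast
    qed
    have "far p M (a m) (g s)" if "m \<ge> N" "t \<le> s" for m s
    proof -
      have "far p t (f m t) (a m)" using far_btw[OF fb[OF that(1)]] ft[OF that(1)] by simp
      then have f1: "far p (M + 2 * \<delta>) (a m) (f m t)" using t d by (auto simp: far_sym intro: far_mono)
      have f2: "far p (M + 2 * \<delta>) (f m t) (g t)"
        by (rule far_near[OF fg[OF that(1)]]) (use ft that t in simp)
      have "far (g 0) (dist (g 0) (g t)) (g t) (g s)"
        by (rule far_btw[OF ray_btw]) (use \<open>geodesic_ray g\<close> t that in auto)
      then have f3: "far p (M + 2 * \<delta> - \<delta>) (g t) (g s)"
        using t d \<open>geodesic_ray g\<close> g0 by (auto simp: ray_dist intro: far_mono)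
      have "far p (M + 2 * \<delta> - \<delta> - \<delta>) (a m) (g s)"
        by (rule far_trans[OF far_trans[OF f1 f2] f3])
      then show ?thesis by simp
    qed
    then have "\<forall>m\<ge>max N (nat \<lceil>t\<rceil>). \<forall>s\<ge>max N (nat \<lceil>t\<rceil>). far p M (a m) (g (real s))"
      by (simp add: nat_ceiling_le_eq)
    then show "far_seq p M a (\<lambda>n. g (real n))" unfolding far_seq_def by blast
  qed
  ultimately show thesis by (rule that)
qed

lemma Gromov_sequence_limit:
  assumes "seq_equiv a (a::nat \<Rightarrow> 'a)" shows "\<exists>\<xi>. represents a (Inr \<xi>)"
proof -
  obtain c where "geodesic_ray c" "seq_equiv a (\<lambda>n. c (real n))"
    using Gromov_sequence_ray[OF assms] by blast
  then have "represents a (Inr (asymptotic_rel `` {c}))"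
    unfolding represents_Inr using boundary_class by blast
  then show ?thesis ..
qed

text \<open>The rays of a boundary class start anywhere. The points of one of them form a Gromov
  sequence, which yields an asymptotic ray starting at \<open>p\<close>.\<close>

lemma generalized_ray_exists:
  assumes "u \<in> hyp_points" shows "\<exists>c. generalized_ray (p::'a) c u"
proof (cases u)
  case (Inl x) then show ?thesis using generalized_ray_Inl_exists by blast
next
  case (Inr \<xi>)
  then have xi: "\<xi> \<in> gromov_boundary" using assms by (auto simp: hyp_points_def)
  then obtain c where c: "c \<in> \<xi>" using boundary_nonempty by blast
  have "seq_equiv (\<lambda>n. c (real n)) (\<lambda>n. c (real n))"
    by (rule asymptotic_seq_equiv[OF boundary_asymptotic[OF xi c c]])
  then obtain c' where c': "geodesic_ray c'" "c' 0 = p" "seq_equiv (\<lambda>n. c (real n)) (\<lambda>n. c' (real n))"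
    by (rule Gromov_sequence_ray)
  then have "(c, c') \<in> asymptotic_rel" using seq_equiv_asymptotic boundary_ray[OF xi c] by blast
  then have "\<xi> = asymptotic_rel `` {c'}" using boundary_eqI[OF xi _ c] boundary_class c'(1) by blast
  then show ?thesis using Inr c' boundary_class by (auto simp: generalized_ray_Inr)
qed

end

section \<open>Convergence in the compactification\<close>

text \<open>A generalized ray that reaches distance \<open>M\<close> from \<open>p\<close> cannot
  have come to rest before time \<open>M\<close>.\<close>

lemma generalized_ray_dist:
  assumes c: "generalized_ray p c u" and M: "0 \<le> s0" "M \<le> dist p (c s0)"
    and st: "0 \<le> s" "0 \<le> t" "s \<le> M" "t \<le> M"
  shows "dist (c s) (c t) = \<bar>s - t\<bar>"
proof (cases u)
  case (Inl x)
  then have "c 0 = p" and d: "\<And>s t. s \<ge> 0 \<Longrightarrow> t \<ge> 0 \<Longrightarrow> dist (c s) (c t) = \<bar>min s (dist p x) - min t (dist p x)\<bar>"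
    using c by (auto simp: generalized_ray_Inl)
  then have "M \<le> dist p x" using d[of 0 s0] M by auto
  then show ?thesis using d[OF st(1,2)] st by (simp add: min_def)
next
  case (Inr \<xi>) then show ?thesis using c st by (simp add: generalized_ray_Inr ray_dist)
qed

lemma generalized_ray_point: "generalized_ray p c u \<Longrightarrow> u \<in> hyp_points"
  by (cases u) (auto simp: hyp_points_def generalized_ray_Inr)

lemma hyp_converges_points:
  assumes "hyp_converges p u l" shows "u n \<in> hyp_points" "l \<in> hyp_points"
proof -
  obtain c where c: "\<forall>n. generalized_ray p (c n) (u n)"
    "\<forall>r::nat \<Rightarrow> nat. strict_mono r \<longrightarrow> (\<exists>s c'. strict_mono (s::nat \<Rightarrow> nat) \<and> generalized_ray p c' l \<and>
              (\<forall>K. compact K \<longrightarrow> K \<subseteq> {0..} \<longrightarrow> uniform_limit K (\<lambda>n. c (r (s n))) c' sequentially))"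
    using assms unfolding hyp_converges_def by blast
  show "u n \<in> hyp_points" using c(1) generalized_ray_point by blast
  have "strict_mono (\<lambda>n::nat. n)" by (simp add: strict_mono_def)
  with c(2) obtain c' where "generalized_ray p c' l" by blast
  then show "l \<in> hyp_points" by (rule generalized_ray_point)
qed

lemma hyp_converges_Inl_imp:
  assumes "hyp_converges p u (Inl y)"
  shows "\<exists>x s. strict_mono s \<and> (\<forall>n. u (s n) = Inl (x n)) \<and> x \<longlonglongrightarrow> y"
proof -
  obtain f where f: "\<And>n. generalized_ray p (f n) (u n)"
    and sub: "\<forall>r::nat \<Rightarrow> nat. strict_mono r \<longrightarrow> (\<exists>s c'. strict_mono (s::nat \<Rightarrow> nat) \<and> generalized_ray p c' (Inl y) \<and>
              (\<forall>K. compact K \<longrightarrow> K \<subseteq> {0..} \<longrightarrow> uniform_limit K (\<lambda>n. f (r (s n))) c' sequentially))"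
    using assms unfolding hyp_converges_def by blast
  have id: "strict_mono (\<lambda>n::nat. n)" by (simp add: strict_mono_def)
  obtain s c' where s: "strict_mono (s::nat \<Rightarrow> nat)" and c': "generalized_ray p c' (Inl y)"
    and ul: "\<forall>K. compact K \<longrightarrow> K \<subseteq> {0..} \<longrightarrow> uniform_limit K (\<lambda>n. f (s n)) c' sequentially"
    using sub[THEN spec, THEN mp, OF id] by blast
  \<comment> \<open>At this time the limit path rests at \<open>y\<close>. A path then less than 1
    away from \<open>y\<close> is at distance less than \<open>t\<close> from \<open>p\<close>, so
    it has come to rest as well and its endpoint is its value at \<open>t\<close>.\<close>
  define t where "t = dist p y + 1"
  have t: "0 \<le> t" "dist p y < t" by (simp_all add: t_def add_nonneg_pos)
  have lim: "(\<lambda>n. f (s n) t) \<longlonglongrightarrow> y"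
    using ul[THEN spec, of "{t}"] t c' by (simp add: generalized_ray_Inl)
  then have "\<forall>\<^sub>F n in sequentially. dist (f (s n) t) y < 1" by (rule tendstoD) simp
  then obtain N where N: "\<And>n. n \<ge> N \<Longrightarrow> dist (f (s n) t) y < 1" by (auto simp: eventually_sequentially)
  have u: "u (s n) = Inl (f (s n) t)" if "n \<ge> N" for n
  proof -
    have pt: "dist p (f (s n) t) < t"
      using N[OF that] dist_triangle[of p "f (s n) t" y] dist_commute[of y "f (s n) t"]
      unfolding t_def by linarith
    show ?thesis
    proof (cases "u (s n)")
      case (Inl x)
      then have g: "generalized_ray p (f (s n)) (Inl x)" using f[of "s n"] by simp
      have "dist p x < t"
      proof (rule ccontr)
        assume "\<not> dist p x < t"
        then have "t \<le> dist p (f (s n) (dist p x))" using g by (simp add: generalized_ray_Inl)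
        then have "dist (f (s n) 0) (f (s n) t) = \<bar>0 - t\<bar>"
          by (intro generalized_ray_dist[OF g zero_le_dist]) (use t in auto)
        then show False using pt t(1) generalized_ray_start[OF g] by simp
      qed
      then show ?thesis using g Inl by (simp add: generalized_ray_Inl)
    next
      case (Inr \<xi>)
      then have g: "geodesic_ray (f (s n))" "f (s n) 0 = p" using f[of "s n"] by (auto simp: generalized_ray_Inr)
      then have "dist p (f (s n) t) = t" using ray_dist[OF g(1) _ t(1), of 0] t(1) by simp
      then show ?thesis using pt by simp
    qed
  qed
  have "strict_mono (\<lambda>n. s (n + N))" using s by (simp add: strict_mono_def)
  moreover have "(\<lambda>n. f (s (n + N)) t) \<longlonglongrightarrow> y" using LIMSEQ_ignore_initial_segment[OF lim] .
  ultimately show ?thesis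
    using u by (intro exI[of _ "\<lambda>n. f (s (n + N)) t"] exI[of _ "\<lambda>n. s (n + N)"]) simp
qed

context geodesic_hyperbolic
begin

lemma far_seq_bounded:
  assumes "far_seq p (M + 2 * \<delta> + K) a b" "\<And>n. dist (a n) (a' n) \<le> K" "\<And>n. dist (b n) (b' n) \<le> K"
  shows "far_seq (p::'a) M a' b'"
  using assms(1) far_bounded[OF _ assms(2,3)] unfolding far_seq_def by blast

end

context proper_hyperbolic
begin

lemma hyp_converges_Inl:
  assumes "x \<longlonglongrightarrow> (y::'a)"
  shows "hyp_converges p (\<lambda>n. Inl (x n)) (Inl y)"
proof -
  obtain f where f: "\<And>n. generalized_ray p (f n) (Inl (x n))"
    using choice[of "\<lambda>n c. generalized_ray p c (Inl (x n))"] generalized_ray_Inl_exists by blast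
  have "\<exists>s c'. strict_mono (s::nat \<Rightarrow> nat) \<and> generalized_ray p c' (Inl y) \<and>
              (\<forall>K. compact K \<longrightarrow> K \<subseteq> {0..} \<longrightarrow> uniform_limit K (\<lambda>n. f (r (s n))) c' sequentially)"
    if r: "strict_mono r" for r :: "nat \<Rightarrow> nat"
  proof -
    have f0: "f (r n) 0 = p" for n by (rule generalized_ray_start[OF f])
    have lip: "dist (f (r n) s) (f (r n) t) \<le> \<bar>s - t\<bar>" if "0 \<le> s" "0 \<le> t" for n s t
      by (rule generalized_ray_Lipschitz[OF f that])
    obtain s g where s: "strict_mono (s::nat \<Rightarrow> nat)"
      and ul: "\<And>K. compact K \<Longrightarrow> K \<subseteq> {0..} \<Longrightarrow> uniform_limit K (\<lambda>n. f (r (s n))) g sequentially"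
      using Arzela_Ascoli_Lipschitz[where f = "\<lambda>n. f (r n)", OF proper' lip f0] by metis
    have lim: "(\<lambda>n. f (r (s n)) t) \<longlonglongrightarrow> g t" if "0 \<le> t" for t
      using tendsto_uniform_limitI[OF ul[of "{t}"]] that by auto
    have xs: "(\<lambda>n. x (r (s n))) \<longlonglongrightarrow> y"
      using LIMSEQ_subseq_LIMSEQ[OF LIMSEQ_subseq_LIMSEQ[OF assms r] s] by (simp add: comp_def)
    have g: "dist (g a) (g b) = \<bar>min a (dist p y) - min b (dist p y)\<bar>" if "0 \<le> a" "0 \<le> b" for a b
    proof (rule LIMSEQ_unique)
      show "(\<lambda>n. dist (f (r (s n)) a) (f (r (s n)) b)) \<longlonglongrightarrow> dist (g a) (g b)"
        by (intro tendsto_dist lim that)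
      have "(\<lambda>n. dist (f (r (s n)) a) (f (r (s n)) b)) =
          (\<lambda>n. \<bar>min a (dist p (x (r (s n)))) - min b (dist p (x (r (s n))))\<bar>)"
        using f that by (auto simp: generalized_ray_Inl)
      also have "\<dots> \<longlonglongrightarrow> \<bar>min a (dist p y) - min b (dist p y)\<bar>"
        by (intro tendsto_rabs tendsto_diff tendsto_min tendsto_const tendsto_dist xs)
      finally show "(\<lambda>n. dist (f (r (s n)) a) (f (r (s n)) b)) \<longlonglongrightarrow> \<bar>min a (dist p y) - min b (dist p y)\<bar>" .
    qed
    have g0: "g 0 = p" using lim[of 0] by (simp add: f0 LIMSEQ_const_iff)
    \<comment> \<open>The paths stop at varying times that converge to \<open>dist p y\<close>; one
      unit later almost all of them have stopped.\<close>
    have gy: "g (dist p y + 1) = y"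
    proof (rule LIMSEQ_unique[OF lim])
      have "\<forall>\<^sub>F n in sequentially. dist p (x (r (s n))) < dist p y + 1"
        by (rule order_tendstoD(2)[OF tendsto_dist[OF tendsto_const xs]]) simp
      then have "\<forall>\<^sub>F n in sequentially. x (r (s n)) = f (r (s n)) (dist p y + 1)"
        by eventually_elim (use f in \<open>simp add: generalized_ray_Inl\<close>)
      then show "(\<lambda>n. f (r (s n)) (dist p y + 1)) \<longlonglongrightarrow> y" using xs tendsto_cong by fast
    qed simp
    have "g t = y" if "dist p y \<le> t" for t
    proof -
      have "0 \<le> t" using that zero_le_dist order_trans by blast
      then show ?thesis using g[of t "dist p y + 1"] gy that by simp
    qed
    then have "generalized_ray p g (Inl y)" using g g0 by (simp add: generalized_ray_Inl)
    then show ?thesis using s ul by blast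
  qed
  then show ?thesis unfolding hyp_converges_def using f by blast
qed

text \<open>The rays in the definition of convergence are traded for arbitrary representing
  sequences, a form on which \<open>\<pi>\<close> can act and which treats members of both kinds
  alike.\<close>

lemma hyp_converges_Inr_iff:
  assumes u: "\<And>n. u n \<in> hyp_points" and a: "\<And>n. represents (a n) (u n)"
    and b: "represents b (Inr \<xi>)"
  shows "hyp_converges (p::'a) u (Inr \<xi>) \<longleftrightarrow> (\<forall>M. \<exists>N. \<forall>n\<ge>N. far_seq p M (a n) b)"
proof
  note d = delta_nonneg
  assume far: "\<forall>M. \<exists>N. \<forall>n\<ge>N. far_seq p M (a n) b"
  have xi: "\<xi> \<in> gromov_boundary" using b by (simp add: represents_Inr)
  obtain f where f: "\<And>n. generalized_ray p (f n) (u n)"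
    using choice[of "\<lambda>n c. generalized_ray p c (u n)"] generalized_ray_exists u by blast
  obtain c0 where c0: "generalized_ray p c0 (Inr \<xi>)"
    using generalized_ray_exists[of "Inr \<xi>"] xi by (auto simp: hyp_points_def)
  then have c0': "c0 \<in> \<xi>" "geodesic_ray c0" "c0 0 = p" by (auto simp: generalized_ray_Inr)
  have ff: "\<exists>N. \<forall>n\<ge>N. far_seq p M (\<lambda>m. f n (real m)) (\<lambda>m. c0 (real m))" for M
  proof -
    obtain N where N: "\<And>n. n \<ge> N \<Longrightarrow> far_seq p (M + 2 * \<delta>) (a n) b" using far by meson
    have "far_seq p M (\<lambda>m. f n (real m)) (\<lambda>m. c0 (real m))" if "n \<ge> N" for n
    proof -
      have "far_seq p (M + 2 * \<delta> - \<delta>) (\<lambda>m. f n (real m)) b"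
        by (rule represents_far_seq[OF a represents_generalized_ray[OF f] N[OF that]])
      then have "far_seq p (M + 2 * \<delta> - \<delta> - \<delta>) (\<lambda>m. c0 (real m)) (\<lambda>m. f n (real m))"
        by (rule represents_far_seq[OF b represents_generalized_ray[OF c0] far_seq_sym])
      then have "far_seq p M (\<lambda>m. c0 (real m)) (\<lambda>m. f n (real m))" by simp
      then show ?thesis by (rule far_seq_sym)
    qed
    then show ?thesis by blast
  qed
  \<comment> \<open>On any bounded time interval, late paths move at unit speed and stay near the
    fixed ray \<open>c0\<close>. Their limits are therefore rays in the class of
    \<open>c0\<close>.\<close>
  have close: "\<exists>N. \<forall>n\<ge>N. (\<forall>s t. 0 \<le> s \<longrightarrow> s \<le> M \<longrightarrow> 0 \<le> t \<longrightarrow> t \<le> M \<longrightarrow> dist (f n s) (f n t) = \<bar>s - t\<bar>) \<and>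
      (\<forall>t. 0 \<le> t \<longrightarrow> t \<le> M \<longrightarrow> dist (f n t) (c0 t) \<le> 6 * \<delta>)" for M
  proof -
    obtain N where N: "\<And>n. n \<ge> N \<Longrightarrow> far_seq p (M + \<delta> + 1) (\<lambda>m. f n (real m)) (\<lambda>m. c0 (real m))"
      using ff by meson
    have "dist (f n s) (f n t) = \<bar>s - t\<bar> \<and> dist (f n t) (c0 t) \<le> 6 * \<delta>"
      if n: "n \<ge> N" and st: "0 \<le> s" "s \<le> M" "0 \<le> t" "t \<le> M" for n s t
    proof -
      obtain T where T: "\<And>m m'. m \<ge> T \<Longrightarrow> m' \<ge> T \<Longrightarrow> far p (M + \<delta> + 1) (f n (real m)) (c0 (real m'))"
        using N[OF n] unfolding far_seq_def by meson
      define m where "m = max T (nat \<lceil>t\<rceil>)"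
      have m: "m \<ge> T" "t \<le> real m" by (auto simp: m_def) (meson max.cobounded2 nat_ceiling_le_eq)
      have fm: "M \<le> dist p (f n (real m))" using far_left[OF T[OF m(1) m(1)]] d by linarith
      have iso: "dist (f n s) (f n t) = \<bar>s - t\<bar>" if "0 \<le> s" "0 \<le> t" "s \<le> M" "t \<le> M" for s t
        by (rule generalized_ray_dist[OF f _ fm that]) simp
      have ft: "dist p (f n t) = t" using iso[of 0 t] st generalized_ray_start[OF f] by simp
      have b: "btw p (f n t) (f n (real m))" "btw p (c0 t) (c0 (real m))"
        using generalized_ray_btw[OF f st(3) m(2)] generalized_ray_btw[OF c0 st(3) m(2)] by auto
      have "dist (f n t) (c0 t) \<le> 6 * \<delta> + 3 * dist p p + \<bar>dist p (f n t) - dist p (c0 t)\<bar>"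
        by (rule thin[OF b T[OF m(1) m(1)]]) (use ft st in simp)
      moreover have "dist p (c0 t) = t" using ray_dist[OF c0'(2), of 0 t] c0'(3) st by simp
      ultimately show ?thesis using ft iso st by simp
    qed
    then show ?thesis by blast
  qed
  have "\<exists>s c'. strict_mono (s::nat \<Rightarrow> nat) \<and> generalized_ray p c' (Inr \<xi>) \<and>
              (\<forall>K. compact K \<longrightarrow> K \<subseteq> {0..} \<longrightarrow> uniform_limit K (\<lambda>n. f (r (s n))) c' sequentially)"
    if r: "strict_mono r" for r :: "nat \<Rightarrow> nat"
  proof -
    have f0: "f (r n) 0 = p" for n by (rule generalized_ray_start[OF f])
    have lip: "dist (f (r n) s) (f (r n) t) \<le> \<bar>s - t\<bar>" if "0 \<le> s" "0 \<le> t" for n s t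
      by (rule generalized_ray_Lipschitz[OF f that])
    obtain s g where s: "strict_mono (s::nat \<Rightarrow> nat)"
      and ul: "\<And>K. compact K \<Longrightarrow> K \<subseteq> {0..} \<Longrightarrow> uniform_limit K (\<lambda>n. f (r (s n))) g sequentially"
      using Arzela_Ascoli_Lipschitz[where f = "\<lambda>n. f (r n)", OF proper' lip f0] by metis
    have lim: "(\<lambda>n. f (r (s n)) t) \<longlonglongrightarrow> g t" if "0 \<le> t" for t
      using tendsto_uniform_limitI[OF ul[of "{t}"]] that by auto
    have rs: "n \<le> r (s n)" for n using seq_suble[OF r, of "s n"] seq_suble[OF s, of n] by simp
    have iso: "dist (g x) (g y) = \<bar>x - y\<bar>" if "0 \<le> x" "0 \<le> y" for x y
    proof (rule LIMSEQ_unique[OF tendsto_dist[OF lim lim]])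
      have "\<exists>N. \<forall>n\<ge>N. dist (f n x) (f n y) = \<bar>x - y\<bar>"
        using close[of "max x y"] that max.cobounded1[of x y] max.cobounded2[of y x] by blast
      then obtain N where N: "\<forall>n\<ge>N. dist (f n x) (f n y) = \<bar>x - y\<bar>" ..
      have "\<forall>\<^sub>F n in sequentially. dist (f (r (s n)) x) (f (r (s n)) y) = \<bar>x - y\<bar>"
        unfolding eventually_sequentially using N rs le_trans by blast
      then show "(\<lambda>n. dist (f (r (s n)) x) (f (r (s n)) y)) \<longlonglongrightarrow> \<bar>x - y\<bar>" by (rule tendsto_eventually)
    qed (use that in auto)
    have gc: "dist (c0 t) (g t) \<le> 6 * \<delta>" if t: "0 \<le> t" for t
    proof (rule LIMSEQ_le_const2[OF tendsto_dist[OF tendsto_const lim[OF t]]])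
      have "\<exists>N. \<forall>n\<ge>N. dist (f n t) (c0 t) \<le> 6 * \<delta>" using close[of t] t by blast
      then show "\<exists>N. \<forall>n\<ge>N. dist (c0 t) (f (r (s n)) t) \<le> 6 * \<delta>"
        using rs le_trans dist_commute by metis
    qed
    have "geodesic_ray g" using iso by (simp add: geodesic_ray_def isometric_on_def)
    moreover from this gc c0'(2) have "(c0, g) \<in> asymptotic_rel" by (auto simp: asymptotic_rel_def)
    then have "g \<in> \<xi>"
      using boundary_eqI[OF xi boundary_class(1) c0'(1) boundary_class(2)] \<open>geodesic_ray g\<close> boundary_class(2)
      by blast
    moreover have "g 0 = p" using lim[of 0] by (simp add: f0 LIMSEQ_const_iff)
    ultimately have "generalized_ray p g (Inr \<xi>)" using xi by (simp add: generalized_ray_Inr)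
    then show ?thesis using s ul by blast
  qed
  then show "hyp_converges p u (Inr \<xi>)" unfolding hyp_converges_def using f by blast
next
  note d = delta_nonneg
  assume "hyp_converges p u (Inr \<xi>)"
  then obtain f where f: "\<And>n. generalized_ray p (f n) (u n)"
    and sub: "\<And>r::nat \<Rightarrow> nat. strict_mono r \<Longrightarrow> \<exists>s c'. strict_mono (s::nat \<Rightarrow> nat) \<and> generalized_ray p c' (Inr \<xi>) \<and>
              (\<forall>K. compact K \<longrightarrow> K \<subseteq> {0..} \<longrightarrow> uniform_limit K (\<lambda>n. f (r (s n))) c' sequentially)"
    unfolding hyp_converges_def by blast
  show "\<forall>M. \<exists>N. \<forall>n\<ge>N. far_seq p M (a n) b"
  proof (rule ccontr)
    assume "\<not> ?thesis"
    then obtain M where M: "\<forall>N. \<exists>n\<ge>N. \<not> far_seq p M (a n) b" by blast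
    then have "infinite {n. \<not> far_seq p M (a n) b}" by (simp add: infinite_nat_iff_unbounded_le)
    then obtain r :: "nat \<Rightarrow> nat" where r: "strict_mono r" "\<And>n. \<not> far_seq p M (a (r n)) b"
      using infinite_enumerate by (metis mem_Collect_eq)
    \<comment> \<open>At time \<open>t\<close> the path may be nearer to \<open>p\<close> by 1 than
      \<open>c'\<close>, and the short leg between them costs another 1. The
      \<open>4 * \<delta>\<close> pay for two joints and two changes of representing
      sequence.\<close>
    define t where "t = \<bar>M\<bar> + 2 + 4 * \<delta>"
    have t: "0 \<le> t" "M + 4 * \<delta> \<le> t - 2" using d by (auto simp: t_def)
    obtain s c' where s: "strict_mono (s::nat \<Rightarrow> nat)" and c': "generalized_ray p c' (Inr \<xi>)"
      and ul: "\<forall>K. compact K \<longrightarrow> K \<subseteq> {0..} \<longrightarrow> uniform_limit K (\<lambda>n. f (r (s n))) c' sequentially"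
      using sub[OF r(1)] by blast
    have "(\<lambda>n. f (r (s n)) t) \<longlonglongrightarrow> c' t" using ul[THEN spec, of "{t}"] t by simp
    then have "\<forall>\<^sub>F n in sequentially. dist (f (r (s n)) t) (c' t) < 1" by (rule tendstoD) simp
    then obtain n where n: "dist (f (r (s n)) t) (c' t) < 1" by (auto simp: eventually_sequentially)
    let ?f = "f (r (s n))"
    have c't: "dist p (c' t) = t" using c' t ray_dist[of c' 0 t] by (auto simp: generalized_ray_Inr)
    have ft: "t - 1 \<le> dist p (?f t)" using n c't dist_triangle[of p "c' t" "?f t"] by linarith
    have "far p (t - 2 - 2 * \<delta>) (?f x) (c' y)" if "t \<le> x" "t \<le> y" for x y
    proof -
      have "far p (dist p (?f t)) (?f t) (?f x)" by (rule far_btw[OF generalized_ray_btw[OF f t(1) that(1)]])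
      then have f1: "far p (t - 2) (?f x) (?f t)" using ft by (auto simp: far_sym intro: far_mono)
      have f2: "far p (t - 2) (?f t) (c' t)" by (rule far_near[of _ _ 1]) (use n ft in auto)
      have "far p (dist p (c' t)) (c' t) (c' y)" by (rule far_btw[OF generalized_ray_btw[OF c' t(1) that(2)]])
      then have f3: "far p (t - 2 - \<delta>) (c' t) (c' y)" using c't d by (auto intro: far_mono)
      have "far p (t - 2 - \<delta> - \<delta>) (?f x) (c' y)" by (rule far_trans[OF far_trans[OF f1 f2] f3])
      then show ?thesis by simp
    qed
    then have "\<forall>m\<ge>nat \<lceil>t\<rceil>. \<forall>m'\<ge>nat \<lceil>t\<rceil>. far p (t - 2 - 2 * \<delta>) (?f (real m)) (c' (real m'))"
      by (simp add: nat_ceiling_le_eq)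
    then have "far_seq p (t - 2 - 2 * \<delta>) (\<lambda>m. ?f (real m)) (\<lambda>m. c' (real m))" unfolding far_seq_def by blast
    then have "far_seq p (t - 2 - 2 * \<delta> - \<delta>) (a (r (s n))) (\<lambda>m. c' (real m))"
      by (rule represents_far_seq[OF represents_generalized_ray[OF f] a])
    then have "far_seq p (t - 2 - 2 * \<delta> - \<delta> - \<delta>) b (a (r (s n)))"
      by (rule represents_far_seq[OF represents_generalized_ray[OF c'] b far_seq_sym])
    then have "far_seq p M (a (r (s n))) b" using t(2) far_seq_mono far_seq_sym by fastforce
    then show False using r(2) by blast
  qed
qed

end

section \<open>Closed sets and the boundary map\<close>

definition boundary_closed :: "'a::metric_space \<Rightarrow> (real \<Rightarrow> 'a) set set \<Rightarrow> bool" where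
  "boundary_closed p D \<longleftrightarrow> D \<subseteq> gromov_boundary \<and>
     (\<forall>x \<xi>. (\<forall>n. x n \<in> D) \<longrightarrow> hyp_converges p (\<lambda>n. Inr (x n)) (Inr \<xi>) \<longrightarrow> \<xi> \<in> D)"

definition boundary_limits :: "'a::metric_space \<Rightarrow> 'a set \<Rightarrow> (real \<Rightarrow> 'a) set set" where
  "boundary_limits p A = {\<xi>. \<exists>x. (\<forall>n. x n \<in> A) \<and> hyp_converges p (\<lambda>n. Inl (x n)) (Inr \<xi>)}"

lemma boundary_closedD:
  "boundary_closed p D \<Longrightarrow> \<forall>n. x n \<in> D \<Longrightarrow> hyp_converges p (\<lambda>n. Inr (x n)) (Inr \<xi>) \<Longrightarrow> \<xi> \<in> D"
  unfolding boundary_closed_def by simp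

lemma boundary_limitsI:
  "\<forall>n. x n \<in> A \<Longrightarrow> hyp_converges p (\<lambda>n. Inl (x n)) (Inr \<xi>) \<Longrightarrow> \<xi> \<in> boundary_limits p A"
  unfolding boundary_limits_def by auto

lemma boundary_limits_subset: "boundary_limits p A \<subseteq> gromov_boundary"
  using hyp_converges_points(2) by (fastforce simp: boundary_limits_def hyp_points_def)

lemma boundary_limits_mono: "A \<subseteq> B \<Longrightarrow> boundary_limits p A \<subseteq> boundary_limits p B"
  unfolding boundary_limits_def by fast

lemma boundary_limits_empty [simp]: "boundary_limits p {} = {}"
  by (simp add: boundary_limits_def)

context proper_hyperbolic
begin

text \<open>A sequence has infinitely many members of one kind, and passing to these preserves the
  limit. Convergence to a finite point reduces to metric convergence of a subsequence of finite
  members.\<close>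

lemma hyp_closed_iff:
  "hyp_closed (p::'a) C \<longleftrightarrow> closed (Inl -` C) \<and> boundary_closed p (Inr -` C) \<and>
     boundary_limits p (Inl -` C) \<subseteq> Inr -` C"
proof
  assume C: "hyp_closed p C"
  have lim: "l \<in> C" if "\<And>n. x n \<in> C" "hyp_converges p x l" for x l
    using C that hyp_converges_points(2)[OF that(2)] unfolding hyp_closed_def by blast
  have "closed (Inl -` C)"
    unfolding closed_sequential_limits
  proof (intro allI impI)
    fix x l assume "(\<forall>n. x n \<in> Inl -` C) \<and> x \<longlonglongrightarrow> l"
    then show "l \<in> Inl -` C" using lim[of "\<lambda>n. Inl (x n)"] hyp_converges_Inl by simp
  qed
  moreover have "boundary_closed p (Inr -` C)"
    unfolding boundary_closed_def
  proof (intro conjI allI impI)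
    show "Inr -` C \<subseteq> gromov_boundary" using C by (auto simp: hyp_closed_def hyp_points_def)
    fix x \<xi> assume "\<forall>n. x n \<in> Inr -` C" "hyp_converges p (\<lambda>n. Inr (x n)) (Inr \<xi>)"
    then show "\<xi> \<in> Inr -` C" using lim[of "\<lambda>n. Inr (x n)"] by simp
  qed
  moreover have "boundary_limits p (Inl -` C) \<subseteq> Inr -` C"
  proof
    fix \<xi> assume "\<xi> \<in> boundary_limits p (Inl -` C)"
    then obtain x where "\<forall>n. x n \<in> Inl -` C" "hyp_converges p (\<lambda>n. Inl (x n)) (Inr \<xi>)"
      unfolding boundary_limits_def by blast
    then show "\<xi> \<in> Inr -` C" using lim[of "\<lambda>n. Inl (x n)"] by simp
  qed
  ultimately show "closed (Inl -` C) \<and> boundary_closed p (Inr -` C) \<and>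
     boundary_limits p (Inl -` C) \<subseteq> Inr -` C" by blast
next
  assume "closed (Inl -` C) \<and> boundary_closed p (Inr -` C) \<and> boundary_limits p (Inl -` C) \<subseteq> Inr -` C"
  then have cl: "closed (Inl -` C)" and bc: "boundary_closed p (Inr -` C)"
    and bl: "boundary_limits p (Inl -` C) \<subseteq> Inr -` C" by auto
  show "hyp_closed p C"
    unfolding hyp_closed_def
  proof (intro conjI allI impI)
    show "C \<subseteq> hyp_points"
    proof
      fix u assume "u \<in> C"
      then show "u \<in> hyp_points" using bc by (cases u) (auto simp: boundary_closed_def hyp_points_def)
    qed
    fix u l assume u: "\<forall>n. u n \<in> C" and "l \<in> hyp_points" and conv: "hyp_converges p u l"
    show "l \<in> C"
    proof (cases l)
      case (Inl y)
      then obtain x s where "\<forall>n. u (s n) = Inl (x n)" "x \<longlonglongrightarrow> y"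
        using hyp_converges_Inl_imp conv by blast
      moreover from this u have "\<forall>n. x n \<in> Inl -` C" by (metis vimage_eq)
      ultimately have "y \<in> Inl -` C" using cl unfolding closed_sequential_limits by blast
      then show ?thesis using Inl by simp
    next
      case (Inr \<xi>)
      have sub: "\<exists>r. strict_mono (r::nat \<Rightarrow> nat) \<and> (\<forall>n. r n \<in> S)" if "infinite S" for S
        using infinite_enumerate[OF that] by blast
      have "infinite {n. isl (u n)} \<or> infinite {n. \<not> isl (u n)}"
      proof -
        have "{n. isl (u n)} \<union> {n. \<not> isl (u n)} = UNIV" by auto
        then show ?thesis by (metis finite_Un infinite_UNIV_nat)
      qed
      then have "\<xi> \<in> Inr -` C"
      proof
        assume "infinite {n. isl (u n)}"
        then obtain r where r: "strict_mono (r::nat \<Rightarrow> nat)" "\<forall>n. isl (u (r n))" using sub by blast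
        then have eq: "u \<circ> r = (\<lambda>n. Inl (projl (u (r n))))" by auto
        then have "\<forall>n. projl (u (r n)) \<in> Inl -` C" using u by (metis comp_apply vimageI2)
        moreover have "hyp_converges p (\<lambda>n. Inl (projl (u (r n)))) (Inr \<xi>)"
          using hyp_converges_subseq[OF conv r(1)] Inr eq by simp
        ultimately have "\<xi> \<in> boundary_limits p (Inl -` C)"
          by (rule boundary_limitsI)
        then show ?thesis using bl by blast
      next
        assume "infinite {n. \<not> isl (u n)}"
        then obtain r where r: "strict_mono (r::nat \<Rightarrow> nat)" "\<forall>n. \<not> isl (u (r n))" using sub by blast
        then have eq: "u \<circ> r = (\<lambda>n. Inr (projr (u (r n))))" by auto
        then have "\<forall>n. projr (u (r n)) \<in> Inr -` C" using u by (metis comp_apply vimageI2)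
        moreover have "hyp_converges p (\<lambda>n. Inr (projr (u (r n)))) (Inr \<xi>)"
          using hyp_converges_subseq[OF conv r(1)] Inr eq by simp
        ultimately have "\<xi> \<in> Inr -` C" by (rule boundary_closedD[OF bc])
        then show ?thesis .
      qed
      then show ?thesis using Inr by simp
    qed
  qed
qed

lemma closedin_remainder_hyperbolic:
  "closedin (remainder (hyperbolic_compactification (p::'a))) D \<longleftrightarrow> boundary_closed p D"
proof
  assume "closedin (remainder (hyperbolic_compactification p)) D"
  then show "boundary_closed p D"
    by (auto simp: closedin_remainder closedin_hyperbolic_compactification hyp_closed_iff)
next
  assume D: "boundary_closed p D"
  have v: "Inl -` (Inr ` D :: ('a + _) set) = {}" "Inr -` (Inr ` D :: ('a + _) set) = D" by auto
  have "hyp_closed p (Inr ` D)" unfolding hyp_closed_iff v using D by simp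
  then show "closedin (remainder (hyperbolic_compactification p)) D"
    unfolding closedin_remainder closedin_hyperbolic_compactification using v(2) by metis
qed

text \<open>If \<open>D\<close> contains the limits of sequences in \<open>A\<close>, then
  \<open>A\<close> and \<open>D\<close> together form a closed set by \<open>hyp_closed_iff\<close>,
  and it contains the closure of \<open>A\<close>. Conversely the closure contains those
  limits.\<close>

lemma attaching_map_subset_iff:
  assumes A: "closed A" and D: "boundary_closed (p::'a) D"
  shows "attaching_map (hyperbolic_compactification p) A \<subseteq> D \<longleftrightarrow> boundary_limits p A \<subseteq> D"
proof
  let ?T = "hyperbolic_compactification p"
  let ?E = "?T closure_of (Inl ` A)"
  have "Inl ` A \<subseteq> ?E"
    by (rule closure_of_subset) (auto simp: topspace_hyperbolic_compactification hyp_points_def)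
  moreover have "hyp_closed p ?E"
    unfolding closedin_hyperbolic_compactification[symmetric] by (rule closedin_closure_of)
  ultimately have "A \<subseteq> Inl -` ?E" "boundary_limits p (Inl -` ?E) \<subseteq> Inr -` ?E"
    unfolding hyp_closed_iff by auto
  then have "boundary_limits p A \<subseteq> Inr -` ?E" using boundary_limits_mono by blast
  moreover assume "attaching_map ?T A \<subseteq> D"
  ultimately show "boundary_limits p A \<subseteq> D" unfolding attaching_map_def by blast
next
  let ?T = "hyperbolic_compactification p"
  assume lim: "boundary_limits p A \<subseteq> D"
  let ?C = "Inl ` A \<union> Inr ` D"
  have v: "Inl -` ?C = A" "Inr -` ?C = D" by auto
  have "hyp_closed p ?C" unfolding hyp_closed_iff v using A D lim by simp
  then have "?T closure_of (Inl ` A) \<subseteq> ?C"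
    by (intro closure_of_minimal) (auto simp: closedin_hyperbolic_compactification)
  then show "attaching_map ?T A \<subseteq> D" unfolding attaching_map_def by auto
qed

lemma hyp_converges_Inl_Inr_iff:
  assumes "represents b (Inr \<xi>)"
  shows "hyp_converges (p::'a) (\<lambda>n. Inl (x n)) (Inr \<xi>) \<longleftrightarrow>
    (\<forall>M. \<exists>N. \<forall>n\<ge>N. far_seq p M (\<lambda>_. x n) b)"
  by (rule hyp_converges_Inr_iff[OF _ _ assms]) (auto simp: hyp_points_def represents_Inl)

lemma point_represented:
  assumes "u \<in> hyp_points" shows "\<exists>a. represents a (u :: 'a + (real \<Rightarrow> 'a) set)"
proof -
  obtain c where "generalized_ray undefined c u" using generalized_ray_exists[OF assms] by blast
  then show ?thesis using represents_generalized_ray by blast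
qed

lemma boundary_represented:
  "\<xi> \<in> gromov_boundary \<Longrightarrow> \<exists>a. represents a (Inr (\<xi> :: (real \<Rightarrow> 'a) set))"
  by (rule point_represented) (auto simp: hyp_points_def)

lemma topspace_Pi_functor_hyperbolic:
  "topspace (Pi_functor \<pi> (hyperbolic_compactification (p::'a))) = UNIV <+> gromov_boundary"
  by (auto simp: Pi_functor_def topspace_glue[OF admissible_pullback_attaching] topspace_remainder
      topspace_hyperbolic_compactification hyp_points_def)

lemma closedin_Pi_functor_hyperbolic:
  "closedin (Pi_functor \<pi> (hyperbolic_compactification (p::'a))) C \<longleftrightarrow>
     closed (Inl -` C) \<and> boundary_closed p (Inr -` C) \<and>
     boundary_limits p (closure (\<pi> ` (Inl -` C))) \<subseteq> Inr -` C"
  unfolding Pi_functor_def closedin_glue[OF admissible_pullback_attaching] glue_closed_def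
    closedin_remainder_hyperbolic pullback_map_def
  using attaching_map_subset_iff[OF closed_closure, of p "Inr -` C" "\<pi> ` (Inl -` C)"]
  unfolding closed_closedin[symmetric] by blast

end

section \<open>The boundary map of a quasi-isometry\<close>

locale hyperbolic_quasi_isometry =
  X: proper_hyperbolic \<delta> spX + Y: proper_hyperbolic \<delta>' spY
  for \<delta> \<delta>' :: real and spX :: "'a::metric_space itself" and spY :: "'b::metric_space itself" +
  fixes \<pi> :: "'b \<Rightarrow> 'a" and \<rho> :: "'a \<Rightarrow> 'b"
  assumes qi: "quasi_isometry \<pi>" and qinv: "quasi_inverse \<pi> \<rho>"
begin

lemma geodX: "geodesic_metric TYPE('a)" and geodY: "geodesic_metric TYPE('b)"
  using X.geod Y.geod by (simp_all add: geodesic_metric_def)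

lemma far_image: "\<exists>N. \<forall>x y. far q N x y \<longrightarrow> far p M (\<pi> x) (\<pi> y)"
  by (rule X.quasi_isometry_far[OF geodY qi])

text \<open>Stability is applied to the quasi-inverse; \<open>far_bounded\<close> then leads from
  \<open>\<rho> (\<pi> y)\<close> back to \<open>y\<close>.\<close>

lemma far_preimage: "\<exists>N. \<forall>x y. far p N (\<pi> x) (\<pi> y) \<longrightarrow> far q M x y"
proof -
  obtain K where K: "\<And>y. dist (\<rho> (\<pi> y)) y \<le> K" using qinv unfolding quasi_inverse_def by blast
  have "quasi_isometry \<rho>" using qinv by (simp add: quasi_inverse_def)
  then obtain N where "\<And>x y. far p N x y \<Longrightarrow> far q (M + 2 * \<delta>' + K) (\<rho> x) (\<rho> y)"
    using Y.quasi_isometry_far[OF geodX] by blast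
  then show ?thesis using Y.far_bounded K by blast
qed

lemma far_seq_image: "\<exists>N. \<forall>a b. far_seq q N a b \<longrightarrow> far_seq p M (\<pi> \<circ> a) (\<pi> \<circ> b)"
  using far_image[of q p M] by (auto simp: far_seq_def) meson

lemma far_seq_preimage: "\<exists>N. \<forall>a b. far_seq p N (\<pi> \<circ> a) (\<pi> \<circ> b) \<longrightarrow> far_seq q M a b"
  using far_preimage[of p q M] by (auto simp: far_seq_def) meson

lemma seq_equiv_image: "seq_equiv (\<pi> \<circ> a) (\<pi> \<circ> b) \<longleftrightarrow> seq_equiv a b"
  unfolding seq_equiv_def using far_seq_image far_seq_preimage by meson

text \<open>The sequences representing \<open>\<eta>\<close> have equivalent images, so the choice
  does not depend on \<open>a\<close>; see \<open>represents_boundary_map\<close>.\<close>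

definition boundary_map :: "(real \<Rightarrow> 'b) set \<Rightarrow> (real \<Rightarrow> 'a) set" where
  "boundary_map \<eta> = (SOME \<xi>. \<exists>a. represents a (Inr \<eta>) \<and> represents (\<pi> \<circ> a) (Inr \<xi>))"

lemma represents_boundary_map:
  assumes a: "represents a (Inr \<eta>)"
  shows "represents (\<pi> \<circ> a) (Inr (boundary_map \<eta>))"
proof -
  have "seq_equiv (\<pi> \<circ> a) (\<pi> \<circ> a)"
    using Y.represents_seq_equiv[OF a a] seq_equiv_image by blast
  then have "\<exists>\<xi>. \<exists>a. represents a (Inr \<eta>) \<and> represents (\<pi> \<circ> a) (Inr \<xi>)"
    using X.Gromov_sequence_limit a by blast
  then have "\<exists>a. represents a (Inr \<eta>) \<and> represents (\<pi> \<circ> a) (Inr (boundary_map \<eta>))"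
    unfolding boundary_map_def by (rule someI_ex)
  then obtain a' where a': "represents a' (Inr \<eta>)" "represents (\<pi> \<circ> a') (Inr (boundary_map \<eta>))" by blast
  have "seq_equiv (\<pi> \<circ> a) (\<pi> \<circ> a')"
    using Y.represents_seq_equiv[OF a a'(1)] seq_equiv_image by blast
  then show ?thesis using X.represents_cong a'(2) by blast
qed

text \<open>Injectivity holds because \<open>\<pi>\<close> also reflects equivalence of sequences.
  For surjectivity, \<open>\<pi> \<circ> (\<rho> \<circ> b)\<close> stays at bounded distance from
  \<open>b\<close>; hence \<open>\<rho> \<circ> b\<close> is a Gromov sequence, and its limit is
  mapped to that of \<open>b\<close>.\<close>

lemma bij_boundary_map: "bij_betw boundary_map gromov_boundary gromov_boundary"
proof (rule bij_betw_imageI)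
  show "inj_on boundary_map gromov_boundary"
  proof (rule inj_onI)
    fix \<eta> \<eta>' assume "\<eta> \<in> gromov_boundary" "\<eta>' \<in> gromov_boundary" and eq: "boundary_map \<eta> = boundary_map \<eta>'"
    then obtain a a' where a: "represents a (Inr \<eta>)" "represents a' (Inr \<eta>')"
      using Y.boundary_represented by meson
    then have "seq_equiv (\<pi> \<circ> a) (\<pi> \<circ> a')"
      using X.represents_seq_equiv represents_boundary_map eq by metis
    then have "seq_equiv a a'" by (simp add: seq_equiv_image)
    then show "\<eta> = \<eta>'" using a Y.represents_cong Y.represents_unique by blast
  qed
  show "boundary_map ` gromov_boundary = gromov_boundary"
  proof
    show "boundary_map ` gromov_boundary \<subseteq> gromov_boundary"
      using Y.boundary_represented represents_boundary_map by (fastforce simp: represents_Inr)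
    show "gromov_boundary \<subseteq> boundary_map ` gromov_boundary"
    proof
      fix \<xi> :: "(real \<Rightarrow> 'a) set" assume "\<xi> \<in> gromov_boundary"
      then obtain b where b: "represents b (Inr \<xi>)" using X.boundary_represented by blast
      obtain K where K: "\<And>x. dist (\<pi> (\<rho> x)) x \<le> K" using qinv unfolding quasi_inverse_def by blast
      have Kb: "dist (b n) ((\<pi> \<circ> (\<rho> \<circ> b)) n) \<le> K" for n using K[of "b n"] by (simp add: dist_commute)
      have e: "seq_equiv (\<pi> \<circ> (\<rho> \<circ> b)) b"
        by (rule X.seq_equiv_bounded[OF X.represents_seq_equiv[OF b b] Kb])
      then have "seq_equiv (\<pi> \<circ> (\<rho> \<circ> b)) (\<pi> \<circ> (\<rho> \<circ> b))"
        using X.seq_equiv_trans seq_equiv_sym by blast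
      then have "seq_equiv (\<rho> \<circ> b) (\<rho> \<circ> b)" by (simp only: seq_equiv_image)
      then obtain \<eta> where eta: "represents (\<rho> \<circ> b) (Inr \<eta>)" using Y.Gromov_sequence_limit by blast
      then have "\<xi> = boundary_map \<eta>"
        using X.represents_unique[OF X.represents_cong[OF b e]] represents_boundary_map by blast
      then show "\<xi> \<in> boundary_map ` gromov_boundary" using eta by (auto simp: represents_Inr)
    qed
  qed
qed

lemma boundary_map_in: "\<eta> \<in> gromov_boundary \<Longrightarrow> boundary_map \<eta> \<in> gromov_boundary"
  using bij_boundary_map by (auto simp: bij_betw_def)

lemma hyp_converges_image:
  assumes u: "\<And>n. u n \<in> hyp_points" and eta: "\<eta> \<in> gromov_boundary"
  shows "hyp_converges p (\<lambda>n. map_sum \<pi> boundary_map (u n)) (Inr (boundary_map \<eta>)) \<longleftrightarrow>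
    hyp_converges q u (Inr \<eta>)"
proof -
  have "\<exists>a. represents a (u n)" for n
    by (rule Y.point_represented[OF u])
  then obtain a where a: "\<And>n. represents (a n) (u n)" by metis
  obtain b where b: "represents b (Inr \<eta>)" using Y.boundary_represented[OF eta] by blast
  have a': "represents (\<pi> \<circ> a n) (map_sum \<pi> boundary_map (u n))" for n
  proof (cases "u n")
    case (Inl x)
    then show ?thesis using a[of n] by (auto simp: represents_Inl)
  next
    case (Inr \<xi>)
    then show ?thesis using represents_boundary_map a[of n] by simp
  qed
  have u': "map_sum \<pi> boundary_map (u n) \<in> hyp_points" for n
    using u[of n] boundary_map_in by (cases "u n") (auto simp: hyp_points_def)
  have "hyp_converges p (\<lambda>n. map_sum \<pi> boundary_map (u n)) (Inr (boundary_map \<eta>)) \<longleftrightarrow>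
      (\<forall>M. \<exists>N. \<forall>n\<ge>N. far_seq p M (\<pi> \<circ> a n) (\<pi> \<circ> b))"
    by (rule X.hyp_converges_Inr_iff[OF u' a' represents_boundary_map[OF b]])
  also have "\<dots> \<longleftrightarrow> (\<forall>M. \<exists>N. \<forall>n\<ge>N. far_seq q M (a n) b)"
    using far_seq_image[of q p] far_seq_preimage[of p q] by meson
  also have "\<dots> \<longleftrightarrow> hyp_converges q u (Inr \<eta>)"
    by (rule Y.hyp_converges_Inr_iff[OF u a b, symmetric])
  finally show ?thesis .
qed

lemma boundary_map_cases:
  assumes "\<xi> \<in> gromov_boundary"
  obtains \<eta> where "\<eta> \<in> gromov_boundary" "\<xi> = boundary_map \<eta>"
  using assms bij_boundary_map unfolding bij_betw_def by (metis imageE)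

lemma boundary_map_image_iff:
  assumes "D \<subseteq> gromov_boundary" "\<eta> \<in> gromov_boundary"
  shows "boundary_map \<eta> \<in> boundary_map ` D \<longleftrightarrow> \<eta> \<in> D"
  using assms bij_boundary_map by (meson bij_betw_def inj_on_image_mem_iff)

lemma boundary_closed_image:
  assumes D: "D \<subseteq> gromov_boundary"
  shows "boundary_closed p (boundary_map ` D) \<longleftrightarrow> boundary_closed q D"
proof
  assume c: "boundary_closed p (boundary_map ` D)"
  have "\<eta> \<in> D" if x: "\<forall>n. x n \<in> D" and conv: "hyp_converges q (\<lambda>n. Inr (x n)) (Inr \<eta>)" for x \<eta>
  proof -
    have eta: "\<eta> \<in> gromov_boundary" using hyp_converges_points(2)[OF conv] by (auto simp: hyp_points_def)
    have pts: "Inr (x n) \<in> hyp_points" for n using x D by (auto simp: hyp_points_def)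
    have "hyp_converges p (\<lambda>n. Inr (boundary_map (x n))) (Inr (boundary_map \<eta>))"
      using hyp_converges_image[where p = p and q = q and u = "\<lambda>n. Inr (x n)", OF pts eta] conv by simp
    then have "boundary_map \<eta> \<in> boundary_map ` D"
      by (rule boundary_closedD[OF c, rotated]) (use x in blast)
    then show ?thesis using boundary_map_image_iff[OF D eta] by simp
  qed
  then show "boundary_closed q D" using D unfolding boundary_closed_def by blast
next
  assume c: "boundary_closed q D"
  have "\<xi> \<in> boundary_map ` D"
    if x: "\<forall>n. x n \<in> boundary_map ` D" and conv: "hyp_converges p (\<lambda>n. Inr (x n)) (Inr \<xi>)" for x \<xi>
  proof -
    have "\<xi> \<in> gromov_boundary" using hyp_converges_points(2)[OF conv] by (auto simp: hyp_points_def)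
    then obtain \<eta> where eta: "\<eta> \<in> gromov_boundary" "\<xi> = boundary_map \<eta>" by (rule boundary_map_cases)
    have "\<forall>n. \<exists>y. y \<in> D \<and> x n = boundary_map y" using x by blast
    then obtain y where y: "\<And>n. y n \<in> D" "\<And>n. x n = boundary_map (y n)" by metis
    have pts: "Inr (y n) \<in> hyp_points" for n using y(1) D by (auto simp: hyp_points_def)
    have "hyp_converges q (\<lambda>n. Inr (y n)) (Inr \<eta>)"
      using hyp_converges_image[where p = p and q = q and u = "\<lambda>n. Inr (y n)", OF pts eta(1)] conv y(2) eta(2) by simp
    then have "\<eta> \<in> D" by (rule boundary_closedD[OF c, rotated]) (use y(1) in blast)
    then show ?thesis using eta(2) by blast
  qed
  then show "boundary_closed p (boundary_map ` D)"
    using D boundary_map_in unfolding boundary_closed_def by blast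
qed

text \<open>Taking the closure creates no new limits: its points lie within distance 1 of images of
  points of \<open>A\<close>, and bounded perturbations preserve convergence to the
  boundary.\<close>

lemma boundary_limits_image:
  "boundary_limits p (closure (\<pi> ` A)) = boundary_map ` boundary_limits q A"
proof
  show "boundary_map ` boundary_limits q A \<subseteq> boundary_limits p (closure (\<pi> ` A))"
  proof
    fix \<xi> assume "\<xi> \<in> boundary_map ` boundary_limits q A"
    then obtain \<eta> x where xi: "\<xi> = boundary_map \<eta>" and x: "\<forall>n. x n \<in> A"
      and conv: "hyp_converges q (\<lambda>n. Inl (x n)) (Inr \<eta>)"
      unfolding boundary_limits_def by blast
    have eta: "\<eta> \<in> gromov_boundary" using hyp_converges_points(2)[OF conv] by (auto simp: hyp_points_def)
    have pts: "Inl (x n) \<in> hyp_points" for n by (auto simp: hyp_points_def)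
    have "hyp_converges p (\<lambda>n. Inl (\<pi> (x n))) (Inr \<xi>)"
      using hyp_converges_image[where p = p and q = q and u = "\<lambda>n. Inl (x n)", OF pts eta] conv xi by simp
    moreover have "\<forall>n. \<pi> (x n) \<in> closure (\<pi> ` A)" using x closure_subset by blast
    ultimately show "\<xi> \<in> boundary_limits p (closure (\<pi> ` A))"
      by (rule boundary_limitsI[rotated])
  qed
  show "boundary_limits p (closure (\<pi> ` A)) \<subseteq> boundary_map ` boundary_limits q A"
  proof
    fix \<xi> assume "\<xi> \<in> boundary_limits p (closure (\<pi> ` A))"
    then obtain x where x: "\<And>n. x n \<in> closure (\<pi> ` A)"
      and conv: "hyp_converges p (\<lambda>n. Inl (x n)) (Inr \<xi>)"
      unfolding boundary_limits_def by blast
    have "\<xi> \<in> gromov_boundary" using hyp_converges_points(2)[OF conv] by (auto simp: hyp_points_def)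
    then obtain \<eta> where eta: "\<eta> \<in> gromov_boundary" "\<xi> = boundary_map \<eta>" by (rule boundary_map_cases)
    have "\<exists>y. y \<in> A \<and> dist (x n) (\<pi> y) \<le> 1" for n
    proof -
      have "\<exists>z\<in>\<pi> ` A. dist z (x n) < 1" using x[of n] closure_approachable zero_less_one by blast
      then show ?thesis by (auto simp: dist_commute intro: less_imp_le)
    qed
    then obtain y where y: "\<And>n. y n \<in> A" "\<And>n. dist (x n) (\<pi> (y n)) \<le> 1" by metis
    obtain b where b: "represents b (Inr \<xi>)"
      using Y.boundary_represented[OF eta(1)] represents_boundary_map eta(2) by blast
    have pts: "Inl (y n) \<in> hyp_points" for n by (auto simp: hyp_points_def)
    have 1: "\<forall>M. \<exists>N. \<forall>n\<ge>N. far_seq p M (\<lambda>_. x n) b"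
      using X.hyp_converges_Inl_Inr_iff[OF b] conv by blast
    have "far_seq p M (\<lambda>_. \<pi> (y n)) b" if "far_seq p (M + 2 * \<delta> + 1) (\<lambda>_. x n) b" for M n
      by (rule X.far_seq_bounded[OF that]) (use y(2) in auto)
    then have "\<forall>M. \<exists>N. \<forall>n\<ge>N. far_seq p M (\<lambda>_. \<pi> (y n)) b" using 1 by meson
    then have "hyp_converges p (\<lambda>n. Inl (\<pi> (y n))) (Inr \<xi>)"
      by (rule X.hyp_converges_Inl_Inr_iff[OF b, THEN iffD2])
    then have "hyp_converges q (\<lambda>n. Inl (y n)) (Inr \<eta>)"
      using hyp_converges_image[where p = p and q = q and u = "\<lambda>n. Inl (y n)", OF pts eta(1)] eta(2) by simp
    then have "\<eta> \<in> boundary_limits q A" by (rule boundary_limitsI[rotated]) (use y(1) in blast)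
    then show "\<xi> \<in> boundary_map ` boundary_limits q A" using eta(2) by blast
  qed
qed

text \<open>A set and its image have the same finite part. Their boundary conditions correspond by
  \<open>boundary_closed_image\<close> and \<open>boundary_limits_image\<close>, so closed sets
  match in both directions.\<close>

lemma homeomorphic_map_Pi_functor:
  "homeomorphic_map (hyperbolic_compactification q)
     (Pi_functor \<pi> (hyperbolic_compactification p)) (map_sum id boundary_map)"
proof -
  let ?G = "map_sum id boundary_map :: 'b + (real \<Rightarrow> 'b) set \<Rightarrow> 'b + (real \<Rightarrow> 'a) set"
  let ?S = "hyperbolic_compactification q" and ?T = "Pi_functor \<pi> (hyperbolic_compactification p)"
  have inj: "inj_on ?G hyp_points"
  proof (rule inj_onI)
    fix u v assume "u \<in> hyp_points" "v \<in> hyp_points" "?G u = ?G v"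
    then show "u = v"
      using inj_onD[OF bij_betw_imp_inj_on[OF bij_boundary_map]]
      by (cases u; cases v) (auto simp: hyp_points_def)
  qed
  have surj: "?G ` hyp_points = UNIV <+> gromov_boundary"
  proof -
    have "?G ` hyp_points = Inl ` UNIV \<union> Inr ` (boundary_map ` gromov_boundary)"
      unfolding hyp_points_def Plus_def image_Un image_image by simp
    then show ?thesis by (simp only: Plus_def bij_betw_imp_surj_on[OF bij_boundary_map])
  qed
  have cl: "closedin ?T (?G ` C) \<longleftrightarrow> closedin ?S C" if C: "C \<subseteq> hyp_points" for C
  proof -
    have "?G u = Inl x \<longleftrightarrow> u = Inl x" "?G u = Inr \<xi> \<longleftrightarrow> (\<exists>\<eta>. u = Inr \<eta> \<and> boundary_map \<eta> = \<xi>)"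
      for u x \<xi> by (cases u; simp)+
    note eq = this
    have v: "Inl -` (?G ` C) = Inl -` C" "Inr -` (?G ` C) = boundary_map ` (Inr -` C)"
      unfolding vimage_def image_def by (auto simp: eq eq_commute[of "Inl _"] eq_commute[of "Inr _"])
    have D: "Inr -` C \<subseteq> gromov_boundary" using C by (auto simp: hyp_points_def)
    have "boundary_map ` boundary_limits q (Inl -` C) \<subseteq> boundary_map ` (Inr -` C) \<longleftrightarrow>
        boundary_limits q (Inl -` C) \<subseteq> Inr -` C"
      using bij_boundary_map boundary_limits_subset[of q] D
      by (intro inj_on_image_subset_iff) (auto simp: bij_betw_def)
    then show ?thesis
      unfolding X.closedin_Pi_functor_hyperbolic closedin_hyperbolic_compactification
        Y.hyp_closed_iff v boundary_limits_image[of p _ q] boundary_closed_image[OF D, of p q] by simp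
  qed
  show ?thesis
  proof (rule bijective_closed_imp_homeomorphic_map)
    show "continuous_map ?S ?T ?G"
      unfolding continuous_map_closedin topspace_hyperbolic_compactification
        X.topspace_Pi_functor_hyperbolic
    proof (intro conjI allI impI)
      show "?G \<in> hyp_points \<rightarrow> UNIV <+> gromov_boundary" using surj by blast
      fix C assume C: "closedin ?T C"
      have "C \<subseteq> ?G ` hyp_points"
        using closedin_subset[OF C] unfolding X.topspace_Pi_functor_hyperbolic surj .
      then have "?G ` {x \<in> hyp_points. ?G x \<in> C} = C" by blast
      then show "closedin ?S {x \<in> hyp_points. ?G x \<in> C}" using cl[of "{x \<in> hyp_points. ?G x \<in> C}"] C by simp
    qed
    show "closed_map ?S ?T ?G"
      unfolding closed_map_def using cl closedin_subset topspace_hyperbolic_compactification by blast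
    show "?G ` topspace ?S = topspace ?T"
      using surj by (simp add: topspace_hyperbolic_compactification X.topspace_Pi_functor_hyperbolic)
    show "inj_on ?G (topspace ?S)" using inj by (simp add: topspace_hyperbolic_compactification)
  qed
qed

end

theorem theorem4p9:
  fixes \<pi> :: "'b::metric_space \<Rightarrow> 'a::metric_space" and \<rho> :: "'a \<Rightarrow> 'b"
    and \<delta> \<delta>' :: real and p :: 'a and q :: 'b
  assumes "proper_metric TYPE('a)" and "geodesic_metric TYPE('a)" and "hyperbolic_metric \<delta> TYPE('a)"
    and "proper_metric TYPE('b)" and "geodesic_metric TYPE('b)" and "hyperbolic_metric \<delta>' TYPE('b)"
    and "quasi_isometry \<pi>" and "quasi_inverse \<pi> \<rho>"
  shows "\<exists>h. homeomorphic_map (Pi_functor \<pi> (hyperbolic_compactification p))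
               (hyperbolic_compactification q) h \<and>
             (\<forall>y. h (Inl y) = Inl y)"
proof -
  interpret hyperbolic_quasi_isometry \<delta> \<delta>' "TYPE('a)" "TYPE('b)" \<pi> \<rho>
    by unfold_locales (rule assms)+
  obtain h where h: "homeomorphic_maps (hyperbolic_compactification q)
      (Pi_functor \<pi> (hyperbolic_compactification p)) (map_sum id boundary_map) h"
    using homeomorphic_map_Pi_functor homeomorphic_map_maps by blast
  have "h (Inl y) = Inl y" for y
  proof -
    have "Inl y \<in> topspace (hyperbolic_compactification q)"
      by (auto simp: topspace_hyperbolic_compactification hyp_points_def)
    then have "h (map_sum id boundary_map (Inl y)) = Inl y" using h unfolding homeomorphic_maps_def by blast
    then show ?thesis by simp
  qed
  then show ?thesis using h homeomorphic_maps_sym homeomorphic_maps_map by blast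
qed

end
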